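(* Let $\delta>0$, $q>0$ be constants and let $L(t)$, $T_m(t)$ be given functions of $t>0$. Suppose that $\Psi(x^*,t)$, $X_0^*(t)$, $X_1^*(t)$, together with the function $C(t)$, where $C(t)>0$ for $t>0$ and $C(0)=0$, satisfy $$\frac{\partial\Psi}{\partial t}=\frac{\partial}{\partial x^*}\left(\frac{\Psi_{x^*}}{\Psi^2}\right)+2\delta,\quad X_0^*(t)<x^*<X_1^*(t),\ t>0,$$ with the conditions, for $t>0$, (i) $\displaystyle \frac{1}{\Psi(X_1^*(t),t)}-\delta {X_1^*}^2(t)=-\frac{L(t)}{\delta C(t)}\left(\Psi(X_1^*(t),t)\dot X_1^*(t)+\frac{\Psi_{x^*}(X_1^*(t),t)}{\Psi^2(X_1^*(t),t)}+2\delta X_1^*(t)\right)$, (ii) $\displaystyle \frac{1}{\Psi(X_0^*(t),t)}-\delta {X_0^*}^2(t)=\frac{-q\exp\left(\int_0^tH(\tau)\,d\tau\right)}{\delta C(t)}$, (iii) $\displaystyle \dot C(t)=[L(t)-T_m(t)]\left[\Psi(X_1^*(t),t)\dot X_1^*(t)+\frac{\Psi_{x^*}(X_1^*(t),t)}{\Psi^2(X_1^*(t),t)}+2\delta X_1^*(t)\right]$, where, for $t>0$, $$X_0^*(t)=-\int_0^t\left(\frac{\Psi_{x^*}(X_0^*(\tau),\tau)}{\Psi^3(X_0^*(\tau),\tau)}+2\delta\frac{X_0^*(\tau)}{\Psi(X_0^*(\tau),\tau)}\right)d\tau,\qquad X_1^*(t)=\frac{T_m(t)}{\delta C(t)},$$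 and $$H(t)=-\frac{T_m^3(t)}{L(t)C^2(t)}+\delta\frac{T_m(t)}{L(t)}\frac{1}{\Psi(X_1^*(t),t)}-\frac{\delta}{\Psi(X_1^*(t),t)}+\frac{T_m^2(t)}{C^2(t)}+\frac{\delta}{\Psi(X_0^*(t),t)}-\delta^2{X_0^*}^2(t).$$ Let $x^*=x^*(y,t)$ be defined by the reciprocal transformation $$dy=\Psi\,dx^*+\left(\frac{\Psi_{x^*}}{\Psi^2}+2\delta x^*\right)dt,$$ normalized so that $y=0$ corresponds to $x^*=X_0^*(t)$, and let $$S(t)=\int_{X_0^*(t)}^{X_1^*(t)}\Psi(\sigma,t)\,d\sigma ,$$ with $S(0)=0$. Then the pair $(x^*(y,t),S(t))$ is a solution to the problem $$x^*_t=x^*_{yy}-2\delta x^*x^*_y,\quad 0<y<S(t),\ t>0,$$ $$\dot C(t)=[L(t)-T_m(t)]\,\dot S(t),\quad t>0,$$ $$\left(x^*_y-\delta x^{*2}\right)\big|_{y=S(t)}=-\frac{L(t)\dot S(t)}{\delta C(t)},\quad t>0,$$ $$x^*\big|_{y=S(t)}=\frac{T_m(t)}{\delta C(t)},\quad t>0,$$ $$x^*_y(0,t)-\delta x^{*2}(0,t)=\frac{-q\exp\left(\delta\int_{S(t)}^{0}x^*(\sigma,t)\,d\sigma\right)}{\delta C(t)},\quad t>0.$$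
   Context: Subscripts $t$, $y$, $x^*$ denote partial derivatives and a dot denotes $d/dt$. The symbol $x^*$ denotes both the independent space variable of $\Psi$ and the function $x^*(y,t)$. The reciprocal transformation means that $y=y(x^*,t)$ satisfies $\partial y/\partial x^*=\Psi$ and $\partial y/\partial t=\Psi_{x^*}/\Psi^2+2\delta x^*$, and $x^*(y,t)$ is obtained by inverting $x^*\mapsto y(x^*,t)$ for each fixed $t$.
   Formalization: It is additionally assumed that the integral of σΨ(σ,t) over X_0*(t)<σ<X_1*(t) tends to 0 as t→0+ (S(0)=0 alone does not give the last condition); Ψ is nonzero of either sign, and 0<y<S(t) is read as y strictly between 0 and S(t). *)

theory Defs
  imports "HOL-Analysis.Analysis"
begin

text \<open>
  Functions of space and time take the space variable first. Partial derivatives enter as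
  explicit functions: \<open>\<Psi>x\<close> is the \<open>x\<close>-derivative of \<open>\<Psi>\<close>, one-sided at the end points
  \<open>X0 t\<close> and \<open>X1 t\<close>, where the boundary conditions use it.
\<close>

definition open_strip :: "(real \<Rightarrow> real) \<Rightarrow> (real \<Rightarrow> real) \<Rightarrow> (real \<times> real) set" where
  "open_strip a b = {(x, t). 0 < t \<and> x \<in> open_segment (a t) (b t)}"

definition closed_strip :: "(real \<Rightarrow> real) \<Rightarrow> (real \<Rightarrow> real) \<Rightarrow> (real \<times> real) set" where
  "closed_strip a b = {(x, t). 0 < t \<and> x \<in> closed_segment (a t) (b t)}"

text \<open>The coefficient of \<open>dt\<close> in the reciprocal transformation.\<close>

definition psi_flux ::
  "real \<Rightarrow> (real \<Rightarrow> real \<Rightarrow> real) \<Rightarrow> (real \<Rightarrow> real \<Rightarrow> real) \<Rightarrow> real \<Rightarrow> real \<Rightarrow> real" where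
  "psi_flux \<delta> \<Psi> \<Psi>x x t = \<Psi>x x t / (\<Psi> x t)\<^sup>2 + 2 * \<delta> * x"

text \<open>
  The nonvanishing of \<open>\<Psi>\<close> is what the divisions by \<open>\<Psi>\<close> and the invertibility of
  \<open>x \<mapsto> y(x, t)\<close> require; no sign is imposed on it.
\<close>

definition psi_equation ::
  "real \<Rightarrow> (real \<Rightarrow> real \<Rightarrow> real) \<Rightarrow> (real \<Rightarrow> real \<Rightarrow> real) \<Rightarrow> (real \<Rightarrow> real) \<Rightarrow> (real \<Rightarrow> real) \<Rightarrow> bool"
where
  "psi_equation \<delta> \<Psi> \<Psi>x X0 X1 \<longleftrightarrow>
     (\<forall>t>0. X0 t < X1 t) \<and>
     continuous_on (closed_strip X0 X1) (\<lambda>(x, t). \<Psi> x t) \<and>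
     continuous_on (closed_strip X0 X1) (\<lambda>(x, t). \<Psi>x x t) \<and>
     (\<forall>t>0. \<forall>x\<in>{X0 t..X1 t}. \<Psi> x t \<noteq> 0 \<and>
        ((\<lambda>\<xi>. \<Psi> \<xi> t) has_real_derivative \<Psi>x x t) (at x within {X0 t..X1 t})) \<and>
     (\<exists>\<Psi>t Fx. continuous_on (open_strip X0 X1) (\<lambda>(x, t). \<Psi>t x t) \<and>
        (\<forall>t>0. \<forall>x. X0 t < x \<and> x < X1 t \<longrightarrow>
           ((\<lambda>s. \<Psi> x s) has_real_derivative \<Psi>t x t) (at t) \<and>
           ((\<lambda>\<xi>. \<Psi>x \<xi> t / (\<Psi> \<xi> t)\<^sup>2) has_real_derivative Fx x t) (at x) \<and>
           \<Psi>t x t = Fx x t + 2 * \<delta>))"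

definition H_fun ::
  "real \<Rightarrow> (real \<Rightarrow> real) \<Rightarrow> (real \<Rightarrow> real) \<Rightarrow> (real \<Rightarrow> real) \<Rightarrow> (real \<Rightarrow> real \<Rightarrow> real) \<Rightarrow>
   (real \<Rightarrow> real) \<Rightarrow> (real \<Rightarrow> real) \<Rightarrow> real \<Rightarrow> real" where
  "H_fun \<delta> L Tm C \<Psi> X0 X1 t =
     - (Tm t ^ 3 / (L t * (C t)\<^sup>2)) + \<delta> * (Tm t / L t) * (1 / \<Psi> (X1 t) t)
     - \<delta> / \<Psi> (X1 t) t + (Tm t)\<^sup>2 / (C t)\<^sup>2 + \<delta> / \<Psi> (X0 t) t - \<delta>\<^sup>2 * (X0 t)\<^sup>2"

text \<open>
  \<open>L t \<noteq> 0\<close> is implicit in the quotients by \<open>L\<close> in \<open>H_fun\<close>. The integrals from 0 are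
  Henstock--Kurzweil integrals, so they may be improper at 0; the (arbitrary) values of the
  integrands at 0 are irrelevant.
\<close>

definition psi_problem ::
  "real \<Rightarrow> real \<Rightarrow> (real \<Rightarrow> real) \<Rightarrow> (real \<Rightarrow> real) \<Rightarrow> (real \<Rightarrow> real) \<Rightarrow>
   (real \<Rightarrow> real \<Rightarrow> real) \<Rightarrow> (real \<Rightarrow> real \<Rightarrow> real) \<Rightarrow> (real \<Rightarrow> real) \<Rightarrow> (real \<Rightarrow> real) \<Rightarrow> bool"
where
  "psi_problem \<delta> q L Tm C \<Psi> \<Psi>x X0 X1 \<longleftrightarrow>
     psi_equation \<delta> \<Psi> \<Psi>x X0 X1 \<and>
     C 0 = 0 \<and> continuous_on {0..} C \<and>
     (\<forall>t>0. L t \<noteq> 0 \<and> C t > 0 \<and>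
        C field_differentiable (at t) \<and> X1 field_differentiable (at t) \<and>
        1 / \<Psi> (X1 t) t - \<delta> * (X1 t)\<^sup>2 =
          - (L t / (\<delta> * C t)) * (\<Psi> (X1 t) t * deriv X1 t + psi_flux \<delta> \<Psi> \<Psi>x (X1 t) t) \<and>
        H_fun \<delta> L Tm C \<Psi> X0 X1 integrable_on {0..t} \<and>
        1 / \<Psi> (X0 t) t - \<delta> * (X0 t)\<^sup>2 =
          - q * exp (integral {0..t} (H_fun \<delta> L Tm C \<Psi> X0 X1)) / (\<delta> * C t) \<and>
        deriv C t =
          (L t - Tm t) * (\<Psi> (X1 t) t * deriv X1 t + psi_flux \<delta> \<Psi> \<Psi>x (X1 t) t) \<and>
        (\<lambda>\<tau>. \<Psi>x (X0 \<tau>) \<tau> / \<Psi> (X0 \<tau>) \<tau> ^ 3 + 2 * \<delta> * (X0 \<tau> / \<Psi> (X0 \<tau>) \<tau>))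
          integrable_on {0..t} \<and>
        X0 t = - integral {0..t}
          (\<lambda>\<tau>. \<Psi>x (X0 \<tau>) \<tau> / \<Psi> (X0 \<tau>) \<tau> ^ 3 + 2 * \<delta> * (X0 \<tau> / \<Psi> (X0 \<tau>) \<tau>)) \<and>
        X1 t = Tm t / (\<delta> * C t))"

text \<open>
  The last clause makes precise how \<open>S(0) = 0\<close> acts on the integral in the condition at
  \<open>y = 0\<close>: since \<open>x* dy = \<sigma> \<Psi>(\<sigma>, t) d\<sigma>\<close>, it says that the integral of \<open>x*\<close> over the interval
  between 0 and \<open>S(t)\<close> tends to its value 0 at \<open>t = 0\<close>. It holds whenever \<open>X1\<close> stays bounded
  near 0. It is not automatic, because \<open>X1 = Tm / (\<delta> C)\<close> may blow up: for
  \<open>x*(y, t) = - y / (\<delta> (t + y\<^sup>2 / 2))\<close>, \<open>C(t) = q t\<close> and \<open>S(t) = - sqrt t\<close> all other clauses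
  are satisfied (with \<open>H = 0\<close> and \<open>X0 = 0\<close>), but that integral is a nonzero constant.
\<close>

definition psi_width ::
  "(real \<Rightarrow> real \<Rightarrow> real) \<Rightarrow> (real \<Rightarrow> real) \<Rightarrow> (real \<Rightarrow> real) \<Rightarrow> (real \<Rightarrow> real) \<Rightarrow> bool" where
  "psi_width \<Psi> X0 X1 S \<longleftrightarrow>
     (\<forall>t>0. S t = integral {X0 t..X1 t} (\<lambda>\<sigma>. \<Psi> \<sigma> t)) \<and>
     S 0 = 0 \<and> continuous_on {0..} S \<and>
     ((\<lambda>t. integral {X0 t..X1 t} (\<lambda>\<sigma>. \<sigma> * \<Psi> \<sigma> t)) \<longlongrightarrow> 0) (at_right 0)"

text \<open>
  \<open>y\<close> is the new space variable, \<open>u\<close> is the function \<open>x*(y, t)\<close>; its values outside the image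
  of \<open>y\<close> are unconstrained.
\<close>

definition reciprocal_transformation ::
  "real \<Rightarrow> (real \<Rightarrow> real \<Rightarrow> real) \<Rightarrow> (real \<Rightarrow> real \<Rightarrow> real) \<Rightarrow> (real \<Rightarrow> real) \<Rightarrow> (real \<Rightarrow> real) \<Rightarrow>
   (real \<Rightarrow> real \<Rightarrow> real) \<Rightarrow> (real \<Rightarrow> real \<Rightarrow> real) \<Rightarrow> bool" where
  "reciprocal_transformation \<delta> \<Psi> \<Psi>x X0 X1 y u \<longleftrightarrow>
     (\<forall>t>0.
        (\<forall>x\<in>{X0 t..X1 t}.
           ((\<lambda>\<xi>. y \<xi> t) has_real_derivative \<Psi> x t) (at x within {X0 t..X1 t})) \<and>
        (\<forall>x. X0 t < x \<and> x < X1 t \<longrightarrow>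
           ((\<lambda>s. y x s) has_real_derivative psi_flux \<delta> \<Psi> \<Psi>x x t) (at t)) \<and>
        y (X0 t) t = 0 \<and>
        (\<forall>x\<in>{X0 t..X1 t}. u (y x t) t = x))"

text \<open>
  The space interval is the one between 0 and \<open>S t\<close>: it is \<open>0 < y < S t\<close> if \<open>\<Psi>\<close>, hence
  \<open>S t\<close>, is positive, and \<open>S t < y < 0\<close> if they are negative.
\<close>

definition burgers_problem ::
  "real \<Rightarrow> real \<Rightarrow> (real \<Rightarrow> real) \<Rightarrow> (real \<Rightarrow> real) \<Rightarrow> (real \<Rightarrow> real) \<Rightarrow>
   (real \<Rightarrow> real \<Rightarrow> real) \<Rightarrow> (real \<Rightarrow> real) \<Rightarrow> bool" where
  "burgers_problem \<delta> q L Tm C u S \<longleftrightarrow>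
     (\<exists>uy uyy ut.
        continuous_on (closed_strip (\<lambda>_. 0) S) (\<lambda>(y, t). u y t) \<and>
        continuous_on (closed_strip (\<lambda>_. 0) S) (\<lambda>(y, t). uy y t) \<and>
        continuous_on (open_strip (\<lambda>_. 0) S) (\<lambda>(y, t). ut y t) \<and>
        (\<forall>t>0.
           (\<forall>y\<in>closed_segment 0 (S t).
              ((\<lambda>\<eta>. u \<eta> t) has_real_derivative uy y t) (at y within closed_segment 0 (S t))) \<and>
           (\<forall>y\<in>open_segment 0 (S t).
              ((\<lambda>\<eta>. uy \<eta> t) has_real_derivative uyy y t) (at y) \<and>
              ((\<lambda>s. u y s) has_real_derivative ut y t) (at t) \<and>
              ut y t = uyy y t - 2 * \<delta> * u y t * uy y t) \<and>
           C field_differentiable (at t) \<and> S field_differentiable (at t) \<and>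
           deriv C t = (L t - Tm t) * deriv S t \<and>
           uy (S t) t - \<delta> * (u (S t) t)\<^sup>2 = - (L t * deriv S t / (\<delta> * C t)) \<and>
           u (S t) t = Tm t / (\<delta> * C t) \<and>
           uy 0 t - \<delta> * (u 0 t)\<^sup>2 =
             - q * exp (\<delta> * (LBINT \<sigma>=S t..0. u \<sigma> t)) / (\<delta> * C t)))"

end

theory Submission
  imports Defs
begin

text \<open>
  With the flux \<open>F = \<Psi>\<^sub>x / \<Psi>\<^sup>2 + 2 \<delta> x\<close> the equation for \<open>\<Psi>\<close> is the conservation law
  \<open>\<Psi>\<^sub>t = F\<^sub>x\<close>, and the integral equation for \<open>X0\<close> says that nothing flows through the curve \<open>X0\<close>.
  Hence \<open>y(x, t)\<close> is the mass between \<open>X0 t\<close> and \<open>x\<close>, \<open>y\<^sub>t = F\<close>, and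
  \<open>S' = \<Psi> X1' + F\<close> at \<open>X1\<close>. The inverse function \<open>u\<close> satisfies \<open>u\<^sub>y = 1 / \<Psi>\<close>,
  \<open>u\<^sub>y\<^sub>y = - \<Psi>\<^sub>x / \<Psi>\<^sup>3\<close> and \<open>u\<^sub>t = - F / \<Psi>\<close>, which is the Burgers equation, and the boundary
  conditions translate directly. For the exponent at \<open>y = 0\<close>, the first moment
  \<open>M(t) = \<integral> \<sigma> \<Psi>(\<sigma>, t) d\<sigma> = \<integral> u(\<sigma>, t) d\<sigma>\<close> satisfies \<open>H = - \<delta> M'\<close> by condition (i), and
  \<open>M(t) \<rightarrow> 0\<close> as \<open>t \<rightarrow> 0\<close>.
\<close>

section \<open>Conservation laws on regions with moving boundaries\<close>

text \<open>The mean value theorem for the primitive of \<open>f\<close>. It trades the integral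
  over a thin piece for one value of the integrand, so that continuity alone controls such pieces in
  the limit.\<close>

lemma integral_mean_value:
  fixes f :: "real \<Rightarrow> real"
  assumes "a \<le> b" and "continuous_on {a..b} f"
  obtains x where "x \<in> {a..b}" and "integral {a..b} f = (b - a) * f x"
proof (cases "a = b")
  case True
  then show thesis using that[of a] by simp
next
  case False
  with assms(1) have "a < b" by simp
  have d: "((\<lambda>u. integral {a..u} f) has_derivative (*) (f x)) (at x within {a..b})"
    if "x \<in> {a..b}" for x
    using integral_has_real_derivative[OF assms(2) that]
    by (simp add: has_field_derivative_def)
  then have "\<exists>x\<in>{a<..<b}. integral {a..b} f - integral {a..a} f = f x * (b - a)"
    by (intro mvt_simple[OF \<open>a < b\<close>]) auto
  then obtain x where "x \<in> {a<..<b}" and "integral {a..b} f = f x * (b - a)" by auto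
  then show thesis using that[of x] by (simp add: mult.commute)
qed

section \<open>The Leibniz rule with moving end points\<close>

text \<open>
  No regularity of \<open>b\<close> beyond differentiability at \<open>t0\<close> is available, and \<open>Pt\<close> may be unbounded
  near the moving end point. For \<open>K > \<bar>b'\<bar>\<close> the line \<open>x = b t0 - K \<bar>t - t0\<bar>\<close> stays inside the
  region between the times \<open>t0\<close> and \<open>t\<close>. To its left the classical Leibniz rule applies; the
  remaining pieces have length \<open>O(\<bar>t - t0\<bar>)\<close>, so mean values and the continuity of \<open>P\<close> and \<open>Q\<close>
  up to the boundary suffice.
\<close>

lemma moving_right_endpoint_derivative:
  fixes P Q Pt :: "real \<Rightarrow> real \<Rightarrow> real"
  assumes T: "open T" "t0 \<in> T"
    and cb: "\<And>s. s \<in> T \<Longrightarrow> c < b s"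
    and b: "(b has_real_derivative b') (at t0)"
    and P: "continuous_on {(x, t). t \<in> T \<and> c \<le> x \<and> x \<le> b t} (\<lambda>(x, t). P x t)"
    and Q: "continuous_on {(x, t). t \<in> T \<and> c \<le> x \<and> x \<le> b t} (\<lambda>(x, t). Q x t)"
    and Pt: "continuous_on {(x, t). t \<in> T \<and> c \<le> x \<and> x < b t} (\<lambda>(x, t). Pt x t)"
    and dP: "\<And>x s. s \<in> T \<Longrightarrow> c \<le> x \<Longrightarrow> x < b s \<Longrightarrow>
      ((\<lambda>s. P x s) has_real_derivative Pt x s) (at s)"
    and dQ: "\<And>x s. s \<in> T \<Longrightarrow> c \<le> x \<Longrightarrow> x < b s \<Longrightarrow>
      ((\<lambda>\<xi>. Q \<xi> s) has_real_derivative Pt x s) (at x)"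
  shows "((\<lambda>t. integral {c..b t} (\<lambda>x. P x t)) has_real_derivative
           P (b t0) t0 * b' + Q (b t0) t0 - Q c t0) (at t0)"
proof -
  define D where "D = {(x, t). t \<in> T \<and> c \<le> x \<and> x \<le> b t}"
  \<comment> \<open>The summand 1 makes \<open>K\<close> strictly larger than
    \<open>\<bar>b'\<bar>\<close>, so the difference quotients of \<open>b\<close> near
    \<open>t0\<close> stay below \<open>K\<close> in absolute value.\<close>
  define K where "K = \<bar>b'\<bar> + 1"
  define m where "m = (\<lambda>t. b t0 - K * \<bar>t - t0\<bar>)"
  have K: "K > 0" by (simp add: K_def)
  have quot: "((\<lambda>t. (b t - b t0) / (t - t0)) \<longlongrightarrow> b') (at t0)"
    using b by (simp add: has_field_derivative_iff)
  have bt0: "(b \<longlongrightarrow> b t0) (at t0)"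
    using DERIV_isCont[OF b] by (simp add: isCont_def)
  have mt0: "(m \<longlongrightarrow> b t0) (at t0)"
    unfolding m_def by (auto intro!: tendsto_eq_intros)
  have slice: "continuous_on {c..b s} (\<lambda>x. P x s)" if "s \<in> T" for s
  proof -
    have "continuous_on {c..b s} ((\<lambda>(x, t). P x t) \<circ> (\<lambda>x. (x, s)))"
      by (intro continuous_on_compose continuous_on_subset[OF P])
         (auto intro!: continuous_intros simp: that)
    then show ?thesis by (simp add: o_def)
  qed
  have "\<forall>\<^sub>F t in at t0. \<bar>(b t - b t0) / (t - t0)\<bar> < K"
    using tendsto_rabs[OF quot] by (rule order_tendstoD) (simp add: K_def)
  then obtain r1 where r1: "r1 > 0"
    and lip: "\<And>t. t \<noteq> t0 \<Longrightarrow> dist t t0 < r1 \<Longrightarrow> \<bar>(b t - b t0) / (t - t0)\<bar> < K"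
    unfolding eventually_at by auto
  obtain r2 where r2: "r2 > 0" and ballT: "ball t0 r2 \<subseteq> T"
    using T openE by blast
  have "\<forall>\<^sub>F t in at t0. c < m t"
    using mt0 by (rule order_tendstoD) (simp add: cb T)
  moreover have "\<forall>\<^sub>F t in at t0. dist t t0 < min r1 r2"
    using r1 r2 by (auto simp: eventually_at intro!: exI[of _ "min r1 r2"])
  moreover have "\<forall>\<^sub>F t in at t0. t \<noteq> t0"
    by (simp add: eventually_at_filter)
  \<comment> \<open>The mean-value points depend on \<open>t\<close>. Bundling them into one
    existential triple lets \<open>eventually_ex\<close> choose them together as functions of
    \<open>t\<close>: \<open>\<xi>\<close> is a time, while \<open>\<eta>\<close> and
    \<open>\<theta>\<close> are positions in the thin pieces at the times \<open>t\<close> and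
    \<open>t0\<close>.\<close>
  ultimately have "\<forall>\<^sub>F t in at t0. \<exists>z. case z of (\<xi>, \<eta>, \<theta>) \<Rightarrow>
      t \<in> T \<and> c < m t \<and> \<xi> \<in> closed_segment t0 t \<and> \<xi> \<in> T \<and> m t < b \<xi> \<and>
      \<eta> \<in> {m t..b t} \<and> \<theta> \<in> {m t..b t0} \<and>
      (integral {c..b t} (\<lambda>x. P x t) - integral {c..b t0} (\<lambda>x. P x t0)) / (t - t0) =
        Q (m t) \<xi> - Q c \<xi> + (b t - b t0) / (t - t0) * P \<eta> t
        + K * (\<bar>t - t0\<bar> / (t - t0)) * (P \<eta> t - P \<theta> t0)"
  proof eventually_elim
    case (elim t)
    define J where "J = closed_segment t0 t"
    have JT: "J \<subseteq> T"
    proof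
      fix s assume "s \<in> J"
      then have "dist s t0 \<le> dist t t0"
        unfolding J_def by (metis dist_in_closed_segment dist_commute)
      with elim ballT show "s \<in> T" by (auto simp: dist_commute)
    qed
    \<comment> \<open>For \<open>s\<close> different from \<open>t0\<close>, \<open>\<bar>b s - b
      t0\<bar> < K * \<bar>s - t0\<bar> \<le> K * \<bar>t - t0\<bar>\<close>, so the boundary never
      reaches the point \<open>m t\<close> between the two times.\<close>
    have mb: "m t < b s" if "s \<in> J" for s
    proof (cases "s = t0")
      case True
      then show ?thesis using elim K by (simp add: m_def)
    next
      case False
      have le: "dist s t0 \<le> dist t t0"
        using that unfolding J_def by (metis dist_in_closed_segment dist_commute)
      then have "\<bar>(b s - b t0) / (s - t0)\<bar> < K" using elim lip False by auto
      then have "\<bar>b s - b t0\<bar> < K * \<bar>s - t0\<bar>" using False by (simp add: abs_divide field_simps)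
      also have "\<dots> \<le> K * \<bar>t - t0\<bar>" using le K by (simp add: dist_real_def)
      finally show ?thesis by (simp add: m_def)
    qed
    have tJ: "t \<in> J" "t0 \<in> J" by (auto simp: J_def)
    then have tT: "t \<in> T" using JT by auto
    obtain \<eta> where \<eta>: "\<eta> \<in> {m t..b t}"
      and \<eta>_eq: "integral {m t..b t} (\<lambda>x. P x t) = (b t - m t) * P \<eta> t"
      using mb[of t] tJ elim integral_mean_value[of "m t" "b t" "\<lambda>x. P x t"]
        continuous_on_subset[OF slice[OF tT]]
      by (metis atLeastatMost_subset_iff less_eq_real_def order_refl)
    obtain \<theta> where \<theta>: "\<theta> \<in> {m t..b t0}"
      and \<theta>_eq: "integral {m t..b t0} (\<lambda>x. P x t0) = (b t0 - m t) * P \<theta> t0"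
      using mb[of t0] tJ elim integral_mean_value[of "m t" "b t0" "\<lambda>x. P x t0"]
        continuous_on_subset[OF slice[OF T(2)]]
      by (metis atLeastatMost_subset_iff less_eq_real_def order_refl)
    \<comment> \<open>While \<open>s\<close> varies, \<open>t\<close> and hence \<open>m t\<close>
      are fixed, so the ordinary Leibniz rule applies. The integral of \<open>Pt\<close> is then
      evaluated in space, where \<open>Pt\<close> is the derivative of \<open>Q\<close>.\<close>
    have g: "((\<lambda>s. integral {c..m t} (\<lambda>x. P x s)) has_real_derivative Q (m t) s - Q c s)
        (at s within J)" if s: "s \<in> J" for s
    proof -
      have "((\<lambda>s. integral (cbox c (m t)) (\<lambda>x. P x s)) has_field_derivative
          integral (cbox c (m t)) (\<lambda>x. Pt x s)) (at s within J)"
      proof (rule leibniz_rule_field_derivative)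
        show "((\<lambda>s. P x s) has_field_derivative Pt x s) (at s within J)"
          if "s \<in> J" "x \<in> cbox c (m t)" for s x
          using that mb[of s] JT by (intro has_field_derivative_at_within[OF dP]) auto
        show "(\<lambda>x. P x s) integrable_on cbox c (m t)" if "s \<in> J" for s
        proof -
          have "{c..m t} \<subseteq> {c..b s}" using mb[OF that] by auto
          moreover have "continuous_on {c..b s} (\<lambda>x. P x s)" using JT that slice by auto
          ultimately have "continuous_on {c..m t} (\<lambda>x. P x s)" by (rule continuous_on_subset[rotated])
          then show ?thesis by (simp add: integrable_continuous_interval)
        qed
        have "(\<lambda>(s, x). (x, s)) ` (J \<times> cbox c (m t)) \<subseteq> {(x, t). t \<in> T \<and> c \<le> x \<and> x < b t}"
        proof clarsimp
          fix s x assume "s \<in> J" "c \<le> x" "x \<le> m t"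
          then show "s \<in> T \<and> x < b s" using mb[of s] JT by auto
        qed
        then have "continuous_on (J \<times> cbox c (m t)) (\<lambda>p. (\<lambda>(x, t). Pt x t) ((\<lambda>(s, x). (x, s)) p))"
          by (intro continuous_on_compose2[OF Pt])
            (auto intro!: continuous_intros simp: case_prod_unfold)
        then show "continuous_on (J \<times> cbox c (m t)) (\<lambda>(s, x). Pt x s)"
          by (simp add: case_prod_unfold)
        show "s \<in> J" by fact
        show "convex J" by (simp add: J_def)
      qed
      moreover have "((\<lambda>x. Pt x s) has_integral (Q (m t) s - Q c s)) {c..m t}"
      proof (rule fundamental_theorem_of_calculus)
        show "c \<le> m t" using elim by simp
        show "((\<lambda>x. Q x s) has_vector_derivative Pt x s) (at x within {c..m t})"
          if "x \<in> {c..m t}" for x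
        proof -
          have "((\<lambda>x. Q x s) has_real_derivative Pt x s) (at x)"
            using that mb[OF s] JT s by (intro dQ) auto
          then show ?thesis
            by (simp add: has_real_derivative_iff_has_vector_derivative
                has_vector_derivative_at_within)
        qed
      qed
      ultimately show ?thesis by (simp add: integral_unique)
    qed
    \<comment> \<open>The mean value theorem in time. Times after and before \<open>t0\<close> are
      treated separately and give the same formula.\<close>
    obtain \<xi> where \<xi>: "\<xi> \<in> J" and \<xi>_eq:
      "integral {c..m t} (\<lambda>x. P x t) - integral {c..m t} (\<lambda>x. P x t0) =
        (t - t0) * (Q (m t) \<xi> - Q c \<xi>)"
    proof (cases "t0 < t")
      case True
      then have J: "J = {t0..t}" by (simp add: J_def closed_segment_eq_real_ivl)
      have "\<exists>x\<in>{t0<..<t}. integral {c..m t} (\<lambda>x. P x t) - integral {c..m t} (\<lambda>x. P x t0) =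
          (Q (m t) x - Q c x) * (t - t0)"
        using g by (intro mvt_simple[OF True]) (auto simp: J has_field_derivative_def)
      then obtain x where "x \<in> {t0<..<t}" and "integral {c..m t} (\<lambda>x. P x t) - integral {c..m t} (\<lambda>x. P x t0) =
          (Q (m t) x - Q c x) * (t - t0)" by blast
      then show thesis using that[of x] by (simp add: J mult.commute)
    next
      case False
      with elim have lt: "t < t0" by simp
      then have J: "J = {t..t0}" by (simp add: J_def closed_segment_eq_real_ivl)
      have "\<exists>x\<in>{t<..<t0}. integral {c..m t} (\<lambda>x. P x t0) - integral {c..m t} (\<lambda>x. P x t) =
          (Q (m t) x - Q c x) * (t0 - t)"
        using g by (intro mvt_simple[OF lt]) (auto simp: J has_field_derivative_def)
      then obtain x where "x\<in>{t<..<t0}" and "integral {c..m t} (\<lambda>x. P x t0) - integral {c..m t} (\<lambda>x. P x t) =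
          (Q (m t) x - Q c x) * (t0 - t)" by blast
      then show thesis using that[of x] by (simp add: J algebra_simps)
    qed
    have split: "integral {c..b s} (\<lambda>x. P x s) =
        integral {c..m t} (\<lambda>x. P x s) + integral {m t..b s} (\<lambda>x. P x s)" if "s \<in> J" for s
    proof -
      have "s \<in> T" using that JT by blast
      then show ?thesis
        using mb[OF that] elim integrable_continuous_interval[OF slice]
        by (intro Henstock_Kurzweil_Integration.integral_combine[symmetric]) auto
    qed
    have "integral {c..b t} (\<lambda>x. P x t) - integral {c..b t0} (\<lambda>x. P x t0) =
        (t - t0) * (Q (m t) \<xi> - Q c \<xi>) + (b t - m t) * P \<eta> t - (b t0 - m t) * P \<theta> t0"
      using \<xi>_eq \<eta>_eq \<theta>_eq split tJ by simp
    \<comment> \<open>Uses \<open>b t - m t = (b t - b t0) + K * \<bar>t - t0\<bar>\<close> and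
      \<open>b t0 - m t = K * \<bar>t - t0\<bar>\<close>.\<close>
    also have "\<dots> = (t - t0) * (Q (m t) \<xi> - Q c \<xi>) + (b t - b t0) * P \<eta> t
        + K * \<bar>t - t0\<bar> * (P \<eta> t - P \<theta> t0)"
      by (simp add: m_def algebra_simps)
    finally have "(integral {c..b t} (\<lambda>x. P x t) - integral {c..b t0} (\<lambda>x. P x t0)) / (t - t0) =
        Q (m t) \<xi> - Q c \<xi> + (b t - b t0) / (t - t0) * P \<eta> t
        + K * (\<bar>t - t0\<bar> / (t - t0)) * (P \<eta> t - P \<theta> t0)"
      using elim by (simp add: add_divide_distrib)
    then show ?case
      using \<xi> \<eta> \<theta> tT JT elim mb[OF \<xi>] by (intro exI[of _ "(\<xi>, \<eta>, \<theta>)"]) (auto simp: J_def)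
  qed
  then obtain Z where Z: "\<forall>\<^sub>F t in at t0. case Z t of (\<xi>, \<eta>, \<theta>) \<Rightarrow>
      t \<in> T \<and> c < m t \<and> \<xi> \<in> closed_segment t0 t \<and> \<xi> \<in> T \<and> m t < b \<xi> \<and>
      \<eta> \<in> {m t..b t} \<and> \<theta> \<in> {m t..b t0} \<and>
      (integral {c..b t} (\<lambda>x. P x t) - integral {c..b t0} (\<lambda>x. P x t0)) / (t - t0) =
        Q (m t) \<xi> - Q c \<xi> + (b t - b t0) / (t - t0) * P \<eta> t
        + K * (\<bar>t - t0\<bar> / (t - t0)) * (P \<eta> t - P \<theta> t0)"
    unfolding eventually_ex by blast
  define \<xi> \<eta> \<theta> where "\<xi> = (\<lambda>t. fst (Z t))" and "\<eta> = (\<lambda>t. fst (snd (Z t)))"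
    and "\<theta> = (\<lambda>t. snd (snd (Z t)))"
  have ev: "\<forall>\<^sub>F t in at t0.
      t \<in> T \<and> c < m t \<and> \<xi> t \<in> closed_segment t0 t \<and> \<xi> t \<in> T \<and> m t < b (\<xi> t) \<and>
      \<eta> t \<in> {m t..b t} \<and> \<theta> t \<in> {m t..b t0} \<and>
      (integral {c..b t} (\<lambda>x. P x t) - integral {c..b t0} (\<lambda>x. P x t0)) / (t - t0) =
        Q (m t) (\<xi> t) - Q c (\<xi> t) + (b t - b t0) / (t - t0) * P (\<eta> t) t
        + K * (\<bar>t - t0\<bar> / (t - t0)) * (P (\<eta> t) t - P (\<theta> t) t0)"
    using Z by (simp add: \<xi>_def \<eta>_def \<theta>_def case_prod_unfold)
  have lim\<xi>: "(\<xi> \<longlongrightarrow> t0) (at t0)"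
  proof (rule metric_tendsto_imp_tendsto[OF tendsto_ident_at])
    show "\<forall>\<^sub>F t in at t0. dist (\<xi> t) t0 \<le> dist t t0"
      using ev by eventually_elim (metis dist_in_closed_segment dist_commute)
  qed
  have lim\<eta>: "(\<eta> \<longlongrightarrow> b t0) (at t0)"
    by (rule tendsto_sandwich[OF _ _ mt0 bt0]; use ev in eventually_elim) auto
  have lim\<theta>: "(\<theta> \<longlongrightarrow> b t0) (at t0)"
    by (rule tendsto_sandwich[OF _ _ mt0 tendsto_const]; use ev in eventually_elim) auto
  have comp: "((\<lambda>t. f (X t) (Y t)) \<longlongrightarrow> f x t0) (at t0)"
    if "continuous_on D (\<lambda>(x, t). f x t)" "(X \<longlongrightarrow> x) (at t0)" "(Y \<longlongrightarrow> t0) (at t0)"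
      "(x, t0) \<in> D" "\<forall>\<^sub>F t in at t0. (X t, Y t) \<in> D"
    for f :: "real \<Rightarrow> real \<Rightarrow> real" and X Y x
    using continuous_on_tendsto_compose[OF that(1) tendsto_Pair[OF that(2,3)] that(4,5)] by simp
  have bD: "(b t0, t0) \<in> D" "(c, t0) \<in> D"
    using T cb[of t0] by (auto simp: D_def)
  have PD: "continuous_on D (\<lambda>(x, t). P x t)" and QD: "continuous_on D (\<lambda>(x, t). Q x t)"
    using P Q by (simp_all add: D_def)
  have evD: "\<forall>\<^sub>F t in at t0. (m t, \<xi> t) \<in> D" "\<forall>\<^sub>F t in at t0. (c, \<xi> t) \<in> D"
    "\<forall>\<^sub>F t in at t0. (\<eta> t, t) \<in> D" "\<forall>\<^sub>F t in at t0. (\<theta> t, t0) \<in> D"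
    using ev by (eventually_elim, use T in \<open>simp add: D_def\<close>)+
  have "((\<lambda>t. Q (m t) (\<xi> t)) \<longlongrightarrow> Q (b t0) t0) (at t0)"
    by (rule comp[OF QD mt0 lim\<xi> bD(1) evD(1)])
  moreover have "((\<lambda>t. Q c (\<xi> t)) \<longlongrightarrow> Q c t0) (at t0)"
    by (rule comp[OF QD tendsto_const lim\<xi> bD(2) evD(2)])
  moreover have \<eta>: "((\<lambda>t. P (\<eta> t) t) \<longlongrightarrow> P (b t0) t0) (at t0)"
    by (rule comp[OF PD lim\<eta> tendsto_ident_at bD(1) evD(3)])
  \<comment> \<open>The sign factor has no limit at \<open>t0\<close>, but it is bounded by 1, and
    the difference it multiplies tends to 0 because both values of \<open>P\<close> converge to
    \<open>P (b t0) t0\<close>.\<close>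
  moreover have "((\<lambda>t. K * (\<bar>t - t0\<bar> / (t - t0)) * (P (\<eta> t) t - P (\<theta> t) t0)) \<longlongrightarrow> 0) (at t0)"
  proof (rule Lim_null_comparison)
    have "((\<lambda>t. P (\<theta> t) t0) \<longlongrightarrow> P (b t0) t0) (at t0)"
      by (rule comp[OF PD lim\<theta> tendsto_const bD(1) evD(4)])
    from tendsto_mult[OF tendsto_const[of K] tendsto_rabs[OF tendsto_diff[OF \<eta> this]]]
    show "((\<lambda>t. K * \<bar>P (\<eta> t) t - P (\<theta> t) t0\<bar>) \<longlongrightarrow> 0) (at t0)" by simp
    show "\<forall>\<^sub>F t in at t0. norm (K * (\<bar>t - t0\<bar> / (t - t0)) * (P (\<eta> t) t - P (\<theta> t) t0))
        \<le> K * \<bar>P (\<eta> t) t - P (\<theta> t) t0\<bar>"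
    proof (rule always_eventually, rule allI)
      fix t
      show "norm (K * (\<bar>t - t0\<bar> / (t - t0)) * (P (\<eta> t) t - P (\<theta> t) t0))
          \<le> K * \<bar>P (\<eta> t) t - P (\<theta> t) t0\<bar>"
        using K by (cases "t = t0") (auto simp: abs_mult)
    qed
  qed
  ultimately have "((\<lambda>t. Q (m t) (\<xi> t) - Q c (\<xi> t) + (b t - b t0) / (t - t0) * P (\<eta> t) t
        + K * (\<bar>t - t0\<bar> / (t - t0)) * (P (\<eta> t) t - P (\<theta> t) t0)) \<longlongrightarrow>
      Q (b t0) t0 - Q c t0 + b' * P (b t0) t0 + 0) (at t0)"
    by (intro tendsto_add tendsto_diff tendsto_mult quot)
  then have "((\<lambda>t. (integral {c..b t} (\<lambda>x. P x t) - integral {c..b t0} (\<lambda>x. P x t0)) / (t - t0))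
      \<longlongrightarrow> Q (b t0) t0 - Q c t0 + b' * P (b t0) t0 + 0) (at t0)"
  proof (rule Lim_transform_eventually)
    show "\<forall>\<^sub>F t in at t0. Q (m t) (\<xi> t) - Q c (\<xi> t) + (b t - b t0) / (t - t0) * P (\<eta> t) t
        + K * (\<bar>t - t0\<bar> / (t - t0)) * (P (\<eta> t) t - P (\<theta> t) t0) =
      (integral {c..b t} (\<lambda>x. P x t) - integral {c..b t0} (\<lambda>x. P x t0)) / (t - t0)"
      using ev by eventually_elim simp
  qed
  then show ?thesis by (simp add: has_field_derivative_iff algebra_simps)
qed

text \<open>The reflection of \<open>x\<close> to \<open>- x\<close> exchanges left and right end
  points. It reverses space derivatives, so the density \<open>P (- x)\<close> is paired with the
  flux \<open>- Q (- x)\<close>.\<close>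

lemma moving_left_endpoint_derivative:
  fixes P Q Pt :: "real \<Rightarrow> real \<Rightarrow> real"
  assumes T: "open T" "t0 \<in> T"
    and ac: "\<And>s. s \<in> T \<Longrightarrow> a s < c"
    and a: "(a has_real_derivative a') (at t0)"
    and P: "continuous_on {(x, t). t \<in> T \<and> a t \<le> x \<and> x \<le> c} (\<lambda>(x, t). P x t)"
    and Q: "continuous_on {(x, t). t \<in> T \<and> a t \<le> x \<and> x \<le> c} (\<lambda>(x, t). Q x t)"
    and Pt: "continuous_on {(x, t). t \<in> T \<and> a t < x \<and> x \<le> c} (\<lambda>(x, t). Pt x t)"
    and dP: "\<And>x s. s \<in> T \<Longrightarrow> a s < x \<Longrightarrow> x \<le> c \<Longrightarrow>
      ((\<lambda>s. P x s) has_real_derivative Pt x s) (at s)"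
    and dQ: "\<And>x s. s \<in> T \<Longrightarrow> a s < x \<Longrightarrow> x \<le> c \<Longrightarrow>
      ((\<lambda>\<xi>. Q \<xi> s) has_real_derivative Pt x s) (at x)"
  shows "((\<lambda>t. integral {a t..c} (\<lambda>x. P x t)) has_real_derivative
           Q c t0 - (P (a t0) t0 * a' + Q (a t0) t0)) (at t0)"
proof -
  have reflect: "continuous_on {(x, t). (- x, t) \<in> A} (\<lambda>(x, t). f (- x) t)"
    if "continuous_on A (\<lambda>(x, t). f x t)" for A and f :: "real \<Rightarrow> real \<Rightarrow> real"
  proof -
    have "continuous_on {(x, t). (- x, t) \<in> A} (\<lambda>p. (\<lambda>(x, t). f x t) (- fst p, snd p))"
      by (intro continuous_on_compose2[OF that]) (auto intro!: continuous_intros)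
    then show ?thesis by (simp add: case_prod_unfold)
  qed
  have "((\<lambda>t. integral {- c..- a t} (\<lambda>x. P (- x) t)) has_real_derivative
      P (- (- a t0)) t0 * (- a') + - Q (- (- a t0)) t0 - - Q (- (- c)) t0) (at t0)"
  proof (rule moving_right_endpoint_derivative[OF T, where Pt = "\<lambda>x t. Pt (- x) t"])
    show "- c < - a s" if "s \<in> T" for s using ac[OF that] by simp
    show "((\<lambda>t. - a t) has_real_derivative - a') (at t0)" by (rule DERIV_minus[OF a])
    show "continuous_on {(x, t). t \<in> T \<and> - c \<le> x \<and> x \<le> - a t} (\<lambda>(x, t). P (- x) t)"
      by (rule continuous_on_subset[OF reflect[OF P]]) auto
    show "continuous_on {(x, t). t \<in> T \<and> - c \<le> x \<and> x \<le> - a t} (\<lambda>(x, t). - Q (- x) t)"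
    proof -
      have "continuous_on {(x, t). t \<in> T \<and> - c \<le> x \<and> x \<le> - a t} (\<lambda>(x, t). Q (- x) t)"
        by (rule continuous_on_subset[OF reflect[OF Q]]) auto
      from continuous_on_minus[OF this] show ?thesis by (simp add: case_prod_unfold)
    qed
    show "continuous_on {(x, t). t \<in> T \<and> - c \<le> x \<and> x < - a t} (\<lambda>(x, t). Pt (- x) t)"
      by (rule continuous_on_subset[OF reflect[OF Pt]]) auto
    show "((\<lambda>s. P (- x) s) has_real_derivative Pt (- x) s) (at s)"
      if "s \<in> T" "- c \<le> x" "x < - a s" for x s
      using that by (intro dP) auto
    show "((\<lambda>\<xi>. - Q (- \<xi>) s) has_real_derivative Pt (- x) s) (at x)"
      if "s \<in> T" "- c \<le> x" "x < - a s" for x s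
    proof -
      have "((\<lambda>\<xi>. Q \<xi> s) has_real_derivative Pt (- x) s) (at (- x))"
        using that by (intro dQ) auto
      then have "((\<lambda>\<xi>. Q (- \<xi>) s) has_real_derivative Pt (- x) s * (- 1)) (at x)"
        by (rule DERIV_chain2) (auto intro!: derivative_eq_intros)
      from DERIV_minus[OF this] show ?thesis by simp
    qed
  qed
  moreover have "integral {- c..- a t} (\<lambda>x. P (- x) t) = integral {a t..c} (\<lambda>x. P x t)" for t
    by (rule Henstock_Kurzweil_Integration.integral_reflect_real)
  ultimately show ?thesis by (simp add: algebra_simps)
qed

text \<open>Cutting at a fixed point \<open>c\<close> leaves two pieces with one moving end point
  each, and the fluxes through \<open>c\<close> cancel.\<close>

lemma leibniz_conservation_law:
  fixes P Q Pt :: "real \<Rightarrow> real \<Rightarrow> real"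
  assumes T: "open T" "t0 \<in> T"
    and ab: "\<And>s. s \<in> T \<Longrightarrow> a s < b s"
    and a: "(a has_real_derivative a') (at t0)"
    and b: "(b has_real_derivative b') (at t0)"
    and P: "continuous_on {(x, t). t \<in> T \<and> a t \<le> x \<and> x \<le> b t} (\<lambda>(x, t). P x t)"
    and Q: "continuous_on {(x, t). t \<in> T \<and> a t \<le> x \<and> x \<le> b t} (\<lambda>(x, t). Q x t)"
    and Pt: "continuous_on {(x, t). t \<in> T \<and> a t < x \<and> x < b t} (\<lambda>(x, t). Pt x t)"
    and dP: "\<And>x s. s \<in> T \<Longrightarrow> a s < x \<Longrightarrow> x < b s \<Longrightarrow>
      ((\<lambda>s. P x s) has_real_derivative Pt x s) (at s)"
    and dQ: "\<And>x s. s \<in> T \<Longrightarrow> a s < x \<Longrightarrow> x < b s \<Longrightarrow>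
      ((\<lambda>\<xi>. Q \<xi> s) has_real_derivative Pt x s) (at x)"
  shows "((\<lambda>t. integral {a t..b t} (\<lambda>x. P x t)) has_real_derivative
           P (b t0) t0 * b' + Q (b t0) t0 - (P (a t0) t0 * a' + Q (a t0) t0)) (at t0)"
proof -
  \<comment> \<open>By continuity of \<open>a\<close> and \<open>b\<close> at \<open>t0\<close>, the
    midpoint remains strictly between them for nearby times; \<open>U\<close> below is an open set
    of such times.\<close>
  define c where "c = (a t0 + b t0) / 2"
  have c: "a t0 < c" "c < b t0" using ab[OF T(2)] by (auto simp: c_def)
  have "\<forall>\<^sub>F t in at t0. a t < c" "\<forall>\<^sub>F t in at t0. c < b t"
    using DERIV_isCont[OF a] DERIV_isCont[OF b] c by (auto simp: isCont_def intro: order_tendstoD)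
  then have "\<forall>\<^sub>F t in at t0. t \<in> T \<and> a t < c \<and> c < b t"
    using eventually_at_in_open'[OF T] by eventually_elim simp
  then have "\<forall>\<^sub>F t in nhds t0. t \<in> T \<and> a t < c \<and> c < b t"
    using c T by (auto simp: eventually_nhds_conv_at)
  then obtain U where U: "open U" "t0 \<in> U"
    and UT: "\<And>s. s \<in> U \<Longrightarrow> s \<in> T" and Uc: "\<And>s. s \<in> U \<Longrightarrow> a s < c" "\<And>s. s \<in> U \<Longrightarrow> c < b s"
    unfolding eventually_nhds by blast
  have "((\<lambda>t. integral {a t..c} (\<lambda>x. P x t)) has_real_derivative
      Q c t0 - (P (a t0) t0 * a' + Q (a t0) t0)) (at t0)"
    using UT Uc
    by (intro moving_left_endpoint_derivative[OF U, where Pt = Pt] a dP dQ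
        continuous_on_subset[OF P] continuous_on_subset[OF Q] continuous_on_subset[OF Pt])
       (auto, (meson le_less_trans less_imp_le order_trans)+)
  moreover have "((\<lambda>t. integral {c..b t} (\<lambda>x. P x t)) has_real_derivative
      P (b t0) t0 * b' + Q (b t0) t0 - Q c t0) (at t0)"
    using UT Uc
    by (intro moving_right_endpoint_derivative[OF U, where Pt = Pt] b dP dQ
        continuous_on_subset[OF P] continuous_on_subset[OF Q] continuous_on_subset[OF Pt])
       (auto, (meson less_le_trans less_imp_le order_trans)+)
  ultimately have "((\<lambda>t. integral {a t..c} (\<lambda>x. P x t) + integral {c..b t} (\<lambda>x. P x t))
      has_real_derivative Q c t0 - (P (a t0) t0 * a' + Q (a t0) t0)
        + (P (b t0) t0 * b' + Q (b t0) t0 - Q c t0)) (at t0)"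
    by (rule DERIV_add)
  then have "((\<lambda>t. integral {a t..b t} (\<lambda>x. P x t))
      has_real_derivative Q c t0 - (P (a t0) t0 * a' + Q (a t0) t0)
        + (P (b t0) t0 * b' + Q (b t0) t0 - Q c t0)) (at t0)"
  proof (rule has_field_derivative_transform_within_open[OF _ U])
    fix s assume s: "s \<in> U"
    have "continuous_on {a s..b s} (\<lambda>x. (\<lambda>(x, t). P x t) (x, s))"
      using UT[OF s] by (intro continuous_on_compose2[OF P]) (auto intro!: continuous_intros)
    then show "integral {a s..c} (\<lambda>x. P x s) + integral {c..b s} (\<lambda>x. P x s) =
        integral {a s..b s} (\<lambda>x. P x s)"
      using Uc[OF s] by (intro Henstock_Kurzweil_Integration.integral_combine)
        (auto intro: integrable_continuous_interval)
  qed
  then show ?thesis by (simp add: algebra_simps)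
qed

section \<open>Mass and first moment of the conserved density\<close>

text \<open>The differential form of the problem without its boundary conditions:
  \<open>\<Psi>t\<close> becomes a parameter, the equation becomes the conservation law with flux
  \<open>psi_flux\<close>, and the integral equation for \<open>X0\<close> becomes an equation of
  motion.\<close>

locale psi_solution =
  fixes \<delta> :: real and \<Psi> \<Psi>x \<Psi>t :: "real \<Rightarrow> real \<Rightarrow> real" and X0 X1 :: "real \<Rightarrow> real"
  assumes X0_less_X1: "t > 0 \<Longrightarrow> X0 t < X1 t"
    and continuous_\<Psi>: "continuous_on (closed_strip X0 X1) (\<lambda>(x, t). \<Psi> x t)"
    and continuous_\<Psi>x: "continuous_on (closed_strip X0 X1) (\<lambda>(x, t). \<Psi>x x t)"
    and continuous_\<Psi>t: "continuous_on (open_strip X0 X1) (\<lambda>(x, t). \<Psi>t x t)"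
    and \<Psi>_nonzero: "t > 0 \<Longrightarrow> x \<in> {X0 t..X1 t} \<Longrightarrow> \<Psi> x t \<noteq> 0"
    and deriv_\<Psi>_space: "t > 0 \<Longrightarrow> x \<in> {X0 t..X1 t} \<Longrightarrow>
      ((\<lambda>\<xi>. \<Psi> \<xi> t) has_real_derivative \<Psi>x x t) (at x within {X0 t..X1 t})"
    and deriv_\<Psi>_time: "t > 0 \<Longrightarrow> X0 t < x \<Longrightarrow> x < X1 t \<Longrightarrow>
      ((\<lambda>s. \<Psi> x s) has_real_derivative \<Psi>t x t) (at t)"
    and deriv_flux: "t > 0 \<Longrightarrow> X0 t < x \<Longrightarrow> x < X1 t \<Longrightarrow>
      ((\<lambda>\<xi>. psi_flux \<delta> \<Psi> \<Psi>x \<xi> t) has_real_derivative \<Psi>t x t) (at x)"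
    and deriv_X0: "t > 0 \<Longrightarrow>
      (X0 has_real_derivative - psi_flux \<delta> \<Psi> \<Psi>x (X0 t) t / \<Psi> (X0 t) t) (at t)"
    and deriv_X1: "t > 0 \<Longrightarrow> (X1 has_real_derivative deriv X1 t) (at t)"
begin

abbreviation F :: "real \<Rightarrow> real \<Rightarrow> real" where
  "F \<equiv> psi_flux \<delta> \<Psi> \<Psi>x"

lemma closed_strip_iff: "(x, t) \<in> closed_strip X0 X1 \<longleftrightarrow> t > 0 \<and> X0 t \<le> x \<and> x \<le> X1 t"
  using X0_less_X1[of t] by (auto simp: closed_strip_def closed_segment_eq_real_ivl)

lemma open_strip_iff: "(x, t) \<in> open_strip X0 X1 \<longleftrightarrow> t > 0 \<and> X0 t < x \<and> x < X1 t"
  using X0_less_X1[of t] by (auto simp: open_strip_def open_segment_eq_real_ivl)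

lemma continuous_X0: "continuous_on {0<..} X0" and continuous_X1: "continuous_on {0<..} X1"
  using deriv_X0 deriv_X1
  by (auto intro!: continuous_at_imp_continuous_on intro: DERIV_isCont)

lemma continuous_flux: "continuous_on (closed_strip X0 X1) (\<lambda>(x, t). F x t)"
  using continuous_\<Psi> continuous_\<Psi>x \<Psi>_nonzero
  by (auto simp: psi_flux_def case_prod_unfold closed_strip_iff intro!: continuous_intros)

lemma continuous_slice:
  assumes "continuous_on (closed_strip X0 X1) (\<lambda>(x, t). f x t)" "t > 0"
  shows "continuous_on {X0 t..X1 t} (\<lambda>x. f x t)"
proof -
  have "continuous_on {X0 t..X1 t} (\<lambda>x. (\<lambda>(x, t). f x t) (x, t))"
    using assms(2)
    by (intro continuous_on_compose2[OF assms(1)]) (auto intro!: continuous_intros simp: closed_strip_iff)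
  then show ?thesis by simp
qed

text \<open>Serves both conserved densities, \<open>\<Psi>\<close> and \<open>x * \<Psi>\<close>.
  The velocity of \<open>X0\<close> is inserted explicitly so that the flow through the left end can
  be cancelled afterwards.\<close>

lemma strip_conservation_law:
  fixes P Q Pt :: "real \<Rightarrow> real \<Rightarrow> real"
  assumes t: "t > 0"
    and P: "continuous_on (closed_strip X0 X1) (\<lambda>(x, t). P x t)"
    and Q: "continuous_on (closed_strip X0 X1) (\<lambda>(x, t). Q x t)"
    and Pt: "continuous_on (open_strip X0 X1) (\<lambda>(x, t). Pt x t)"
    and dP: "\<And>x s. s > 0 \<Longrightarrow> X0 s < x \<Longrightarrow> x < X1 s \<Longrightarrow>
      ((\<lambda>s. P x s) has_real_derivative Pt x s) (at s)"
    and dQ: "\<And>x s. s > 0 \<Longrightarrow> X0 s < x \<Longrightarrow> x < X1 s \<Longrightarrow>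
      ((\<lambda>\<xi>. Q \<xi> s) has_real_derivative Pt x s) (at x)"
  shows "((\<lambda>t. integral {X0 t..X1 t} (\<lambda>x. P x t)) has_real_derivative
           P (X1 t) t * deriv X1 t + Q (X1 t) t
           - (P (X0 t) t * (- F (X0 t) t / \<Psi> (X0 t) t) + Q (X0 t) t)) (at t)"
  by (rule leibniz_conservation_law[where T = "{0<..}" and Pt = Pt])
     (use t X0_less_X1 deriv_X0 deriv_X1 dP dQ in
       \<open>auto intro!: continuous_on_subset[OF P] continuous_on_subset[OF Q]
          continuous_on_subset[OF Pt] simp: closed_strip_iff open_strip_iff\<close>)

text \<open>At the left end the velocity of \<open>X0\<close> makes \<open>\<Psi> * X0' + F\<close>
  vanish, which leaves only the flow through \<open>X1\<close>.\<close>

lemma width_has_derivative: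
  assumes "t > 0"
  shows "((\<lambda>t. integral {X0 t..X1 t} (\<lambda>x. \<Psi> x t)) has_real_derivative
           \<Psi> (X1 t) t * deriv X1 t + F (X1 t) t) (at t)"
  using strip_conservation_law[OF assms continuous_\<Psi> continuous_flux continuous_\<Psi>t
      deriv_\<Psi>_time deriv_flux] X0_less_X1[OF assms] \<Psi>_nonzero[OF assms, of "X0 t"]
  by simp

text \<open>
  Integrating \<open>x \<Psi>\<^sub>t = x F\<^sub>x\<close> by parts shows that \<open>x \<Psi>\<close> is conserved as well, with flux
  \<open>x F + 1 / \<Psi> - \<delta> x\<^sup>2\<close>.
\<close>

lemma moment_has_derivative:
  assumes "t > 0"
  shows "((\<lambda>t. integral {X0 t..X1 t} (\<lambda>x. x * \<Psi> x t)) has_real_derivative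
           X1 t * (\<Psi> (X1 t) t * deriv X1 t + F (X1 t) t)
           + (1 / \<Psi> (X1 t) t - \<delta> * (X1 t)\<^sup>2) - (1 / \<Psi> (X0 t) t - \<delta> * (X0 t)\<^sup>2)) (at t)"
proof -
  define Q where "Q = (\<lambda>x t. x * F x t + 1 / \<Psi> x t - \<delta> * x\<^sup>2)"
  have "((\<lambda>t. integral {X0 t..X1 t} (\<lambda>x. x * \<Psi> x t)) has_real_derivative
           X1 t * \<Psi> (X1 t) t * deriv X1 t + Q (X1 t) t
           - (X0 t * \<Psi> (X0 t) t * (- F (X0 t) t / \<Psi> (X0 t) t) + Q (X0 t) t)) (at t)"
  proof (rule strip_conservation_law[OF assms])
    show "continuous_on (closed_strip X0 X1) (\<lambda>(x, t). x * \<Psi> x t)"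
      using continuous_\<Psi> by (auto simp: case_prod_unfold intro!: continuous_intros)
    show "continuous_on (closed_strip X0 X1) (\<lambda>(x, t). Q x t)"
      using continuous_\<Psi> continuous_flux \<Psi>_nonzero
      by (auto simp: case_prod_unfold closed_strip_iff Q_def intro!: continuous_intros)
    show "continuous_on (open_strip X0 X1) (\<lambda>(x, t). x * \<Psi>t x t)"
      using continuous_\<Psi>t by (auto simp: case_prod_unfold intro!: continuous_intros)
    fix x s :: real
    assume s: "s > 0" "X0 s < x" "x < X1 s"
    show "((\<lambda>s. x * \<Psi> x s) has_real_derivative x * \<Psi>t x s) (at s)"
      using deriv_\<Psi>_time[OF s] by (rule DERIV_cmult)
    have nz: "\<Psi> x s \<noteq> 0" using \<Psi>_nonzero s by auto
    have d\<Psi>: "((\<lambda>\<xi>. \<Psi> \<xi> s) has_real_derivative \<Psi>x x s) (at x)"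
      using deriv_\<Psi>_space[of s x] s at_within_Icc_at[of "X0 s" x "X1 s"] by simp
    \<comment> \<open>The space derivative of \<open>1 / \<Psi> - \<delta> * x\<^sup>2\<close> is
      \<open>- F\<close>, which cancels the term \<open>F\<close> produced by differentiating
      \<open>x * F\<close>.\<close>
    show "((\<lambda>\<xi>. Q \<xi> s) has_real_derivative x * \<Psi>t x s) (at x)"
      unfolding Q_def
      by (rule derivative_eq_intros d\<Psi> deriv_flux[OF s] refl nz)+
         (simp add: psi_flux_def power2_eq_square)
  qed
  then show ?thesis
    using X0_less_X1[OF assms] \<Psi>_nonzero[OF assms, of "X0 t"]
    by (simp add: Q_def algebra_simps)
qed

text \<open>Nothing flows through \<open>X0\<close>, and the right end is at rest, so only the flux
  there remains. This gives the time part of the reciprocal transformation for the mass between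
  \<open>X0 t\<close> and \<open>x\<close>.\<close>

lemma partial_width_has_derivative:
  assumes t: "t > 0" and x: "X0 t < x" "x < X1 t"
  shows "((\<lambda>t. integral {X0 t..x} (\<lambda>x. \<Psi> x t)) has_real_derivative F x t) (at t)"
proof -
  \<comment> \<open>The positive times at which \<open>x\<close> lies strictly between
    \<open>X0\<close> and \<open>X1\<close>; they form an open set because both curves are
    continuous.\<close>
  define T where "T = {0<..} \<inter> (\<lambda>t. (X0 t, X1 t)) -` ({..<x} \<times> {x<..})"
  have "((\<lambda>t. integral {X0 t..x} (\<lambda>x. \<Psi> x t)) has_real_derivative
      \<Psi> x t * 0 + F x t - (\<Psi> (X0 t) t * (- F (X0 t) t / \<Psi> (X0 t) t) + F (X0 t) t)) (at t)"
  proof (rule leibniz_conservation_law[where T = T and Pt = \<Psi>t])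
    show "open T"
      unfolding T_def using continuous_X0 continuous_X1
      by (intro continuous_open_preimage) (auto intro!: continuous_intros open_Times)
    show "continuous_on {(\<xi>, t). t \<in> T \<and> X0 t \<le> \<xi> \<and> \<xi> \<le> x} (\<lambda>(x, t). \<Psi> x t)"
      "continuous_on {(\<xi>, t). t \<in> T \<and> X0 t \<le> \<xi> \<and> \<xi> \<le> x} (\<lambda>(x, t). F x t)"
      "continuous_on {(\<xi>, t). t \<in> T \<and> X0 t < \<xi> \<and> \<xi> < x} (\<lambda>(x, t). \<Psi>t x t)"
      by (rule continuous_on_subset[OF continuous_\<Psi>] continuous_on_subset[OF continuous_flux]
          continuous_on_subset[OF continuous_\<Psi>t],
          auto simp: T_def closed_strip_iff open_strip_iff)+
  qed (use t x deriv_X0 in \<open>auto simp: T_def intro!: deriv_\<Psi>_time deriv_flux\<close>)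
  then show ?thesis using X0_less_X1[OF t] \<Psi>_nonzero[OF t, of "X0 t"] by simp
qed

section \<open>Existence of the reciprocal transformation\<close>

lemma slice_inj_on:
  assumes t: "t > 0"
    and y: "\<And>x. x \<in> {X0 t..X1 t} \<Longrightarrow> (g has_real_derivative \<Psi> x t) (at x within {X0 t..X1 t})"
  shows "inj_on g {X0 t..X1 t}"
proof (rule linorder_inj_onI')
  fix i j assume ij: "i \<in> {X0 t..X1 t}" "j \<in> {X0 t..X1 t}" "i < j"
  have "(g has_derivative (*) (\<Psi> x t)) (at x within {i..j})" if "i \<le> x" "x \<le> j" for x
  proof -
    have "(g has_real_derivative \<Psi> x t) (at x within {i..j})"
      by (rule DERIV_subset[OF y]) (use that ij in auto)
    then show ?thesis by (simp add: has_field_derivative_def)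
  qed
  \<comment> \<open>Equal values of \<open>g\<close> at \<open>i\<close> and \<open>j\<close> would
    force a zero of \<open>\<Psi>\<close> in between; this works for either sign of
    \<open>\<Psi>\<close>.\<close>
  then obtain x where "x \<in> {i<..<j}" "g j - g i = \<Psi> x t * (j - i)"
    using mvt_simple[OF ij(3), of g "\<lambda>x. (*) (\<Psi> x t)"] by blast
  then show "g i \<noteq> g j" using \<Psi>_nonzero[OF t, of x] ij by auto
qed

text \<open>The mass between \<open>X0 t\<close> and \<open>x\<close> serves as \<open>y\<close>. It
  is injective on each slice, so \<open>u\<close> can be taken as its inverse there.\<close>

lemma reciprocal_transformation_exists:
  "\<exists>y u. reciprocal_transformation \<delta> \<Psi> \<Psi>x X0 X1 y u"
proof -
  define y where "y = (\<lambda>x t. integral {X0 t..x} (\<lambda>\<sigma>. \<Psi> \<sigma> t))"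
  define u where "u = (\<lambda>\<eta> t. the_inv_into {X0 t..X1 t} (\<lambda>x. y x t) \<eta>)"
  have dy: "((\<lambda>\<xi>. y \<xi> t) has_real_derivative \<Psi> x t) (at x within {X0 t..X1 t})"
    if "t > 0" "x \<in> {X0 t..X1 t}" for x t
    unfolding y_def
    by (rule integral_has_real_derivative[OF continuous_slice[OF continuous_\<Psi>]]) (use that in auto)
  have "u (y x t) t = x" if "t > 0" "x \<in> {X0 t..X1 t}" for x t
    unfolding u_def by (rule the_inv_into_f_f[OF slice_inj_on]) (use dy that in auto)
  then have "reciprocal_transformation \<delta> \<Psi> \<Psi>x X0 X1 y u"
    using dy partial_width_has_derivative by (auto simp: reciprocal_transformation_def y_def)
  then show ?thesis by blast
qed

end

section \<open>The inverse of the reciprocal transformation\<close>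

text \<open>The pair \<open>y\<close>, \<open>u\<close> is arbitrary, so the results hold for every
  reciprocal transformation and not only for the one constructed above.\<close>

locale psi_reciprocal = psi_solution +
  fixes S :: "real \<Rightarrow> real" and y u :: "real \<Rightarrow> real \<Rightarrow> real"
  assumes S_eq: "t > 0 \<Longrightarrow> S t = integral {X0 t..X1 t} (\<lambda>\<sigma>. \<Psi> \<sigma> t)"
    and reciprocal: "reciprocal_transformation \<delta> \<Psi> \<Psi>x X0 X1 y u"
begin

section \<open>The map \<open>y\<close> on a single time slice\<close>

lemma deriv_y_space: "t > 0 \<Longrightarrow> x \<in> {X0 t..X1 t} \<Longrightarrow>
    ((\<lambda>\<xi>. y \<xi> t) has_real_derivative \<Psi> x t) (at x within {X0 t..X1 t})"
  and deriv_y_time: "t > 0 \<Longrightarrow> X0 t < x \<Longrightarrow> x < X1 t \<Longrightarrow>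
    ((\<lambda>s. y x s) has_real_derivative F x t) (at t)"
  and y_X0: "t > 0 \<Longrightarrow> y (X0 t) t = 0"
  and u_y: "t > 0 \<Longrightarrow> x \<in> {X0 t..X1 t} \<Longrightarrow> u (y x t) t = x"
  using reciprocal by (auto simp: reciprocal_transformation_def)

lemma y_X1:
  assumes "t > 0"
  shows "y (X1 t) t = S t"
proof -
  have "((\<lambda>x. \<Psi> x t) has_integral y (X1 t) t - y (X0 t) t) {X0 t..X1 t}"
    using X0_less_X1[OF assms] deriv_y_space[OF assms]
    by (intro fundamental_theorem_of_calculus)
       (auto simp: has_real_derivative_iff_has_vector_derivative)
  then show ?thesis by (simp add: S_eq y_X0 assms integral_unique)
qed

lemma S_has_derivative:
  assumes "t > 0"
  shows "(S has_real_derivative \<Psi> (X1 t) t * deriv X1 t + F (X1 t) t) (at t)"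
  by (rule has_field_derivative_transform_within_open[OF width_has_derivative[OF assms], where S = "{0<..}"])
     (use assms S_eq in auto)

lemma continuous_y_slice: "t > 0 \<Longrightarrow> continuous_on {X0 t..X1 t} (\<lambda>x. y x t)"
  using deriv_y_space by (intro DERIV_continuous_on)

text \<open>A continuous injection carries a segment onto the segment between the images of its
  ends, here 0 and \<open>S t\<close>. Unordered segments cover both signs of
  \<open>S t\<close>.\<close>

lemma y_image:
  assumes t: "t > 0"
  shows "(\<lambda>x. y x t) ` {X0 t..X1 t} = closed_segment 0 (S t)"
    and "(\<lambda>x. y x t) ` {X0 t<..<X1 t} = open_segment 0 (S t)"
proof -
  have *: "closed_segment (X0 t) (X1 t) = {X0 t..X1 t}" "open_segment (X0 t) (X1 t) = {X0 t<..<X1 t}"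
    using X0_less_X1[OF t] by (auto simp: closed_segment_eq_real_ivl open_segment_eq_real_ivl)
  note inj = slice_inj_on[OF t deriv_y_space[OF t]]
  show "(\<lambda>x. y x t) ` {X0 t..X1 t} = closed_segment 0 (S t)"
    using continuous_injective_image_segment_1[of "X0 t" "X1 t" "\<lambda>x. y x t"]
      continuous_y_slice[OF t] inj by (simp add: * y_X0 y_X1 t)
  show "(\<lambda>x. y x t) ` {X0 t<..<X1 t} = open_segment 0 (S t)"
    using continuous_injective_image_open_segment_1[of "X0 t" "X1 t" "\<lambda>x. y x t"]
      continuous_y_slice[OF t] inj by (simp add: * y_X0 y_X1 t)
qed

lemma u_closed:
  assumes "t > 0" "\<eta> \<in> closed_segment 0 (S t)"
  shows "u \<eta> t \<in> {X0 t..X1 t}" "y (u \<eta> t) t = \<eta>"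
proof -
  obtain x where "x \<in> {X0 t..X1 t}" "\<eta> = y x t"
    using assms y_image(1)[OF assms(1)] by blast
  then show "u \<eta> t \<in> {X0 t..X1 t}" "y (u \<eta> t) t = \<eta>" using u_y[OF assms(1)] by auto
qed

lemma u_open:
  assumes "t > 0" "\<eta> \<in> open_segment 0 (S t)"
  shows "X0 t < u \<eta> t" "u \<eta> t < X1 t" "y (u \<eta> t) t = \<eta>"
proof -
  obtain x where "x \<in> {X0 t<..<X1 t}" "\<eta> = y x t"
    using assms y_image(2)[OF assms(1)] by blast
  then show "X0 t < u \<eta> t" "u \<eta> t < X1 t" "y (u \<eta> t) t = \<eta>" using u_y[OF assms(1)] by auto
qed

lemma u_ends: "t > 0 \<Longrightarrow> u 0 t = X0 t" "t > 0 \<Longrightarrow> u (S t) t = X1 t"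
  using u_y[of t "X0 t"] u_y[of t "X1 t"] X0_less_X1[of t] y_X0[of t] y_X1[of t] by auto

section \<open>Joint continuity of \<open>y\<close> and of its inverse\<close>

text \<open>Rescaling each slice to the unit interval turns \<open>y\<close> into a parameter integral.\<close>

lemma continuous_y: "continuous_on (closed_strip X0 X1) (\<lambda>(x, t). y x t)"
proof -
  define \<xi> where "\<xi> = (\<lambda>x t r. X0 t + r * (x - X0 t))"
  have mem: "\<xi> x t r \<in> {X0 t..x}" if "X0 t \<le> x" "r \<in> {0..1}" for x t r
    using that mult_left_le_one_le[of "x - X0 t" r] by (simp add: \<xi>_def)
  have y_eq: "y x t = integral {0..1} (\<lambda>r. \<Psi> (\<xi> x t r) t * (x - X0 t))"
    if "(x, t) \<in> closed_strip X0 X1" for x t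
  proof -
    have t: "t > 0" and x: "X0 t \<le> x" "x \<le> X1 t" using that by (auto simp: closed_strip_iff)
    have "((\<lambda>r. \<Psi> (\<xi> x t r) t * (x - X0 t)) has_integral y (\<xi> x t 1) t - y (\<xi> x t 0) t) {0..1}"
    proof (rule fundamental_theorem_of_calculus)
      fix r :: real assume r: "r \<in> {0..1}"
      \<comment> \<open>At \<open>X0 t\<close> and \<open>X1 t\<close> only one-sided derivatives of
        \<open>y\<close> are available, so the chain rule is applied within the image of the unit
        interval.\<close>
      have im: "\<xi> x t ` {0..1} \<subseteq> {X0 t..X1 t}" using mem[OF x(1)] x by fastforce
      have "((\<lambda>\<xi>. y \<xi> t) has_real_derivative \<Psi> (\<xi> x t r) t) (at (\<xi> x t r) within \<xi> x t ` {0..1})"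
        using r by (intro DERIV_subset[OF deriv_y_space[OF t] im] subsetD[OF im] imageI)
      moreover have "(\<xi> x t has_real_derivative x - X0 t) (at r within {0..1})"
        unfolding \<xi>_def by (auto intro!: derivative_eq_intros)
      ultimately have "((\<lambda>\<xi>. y \<xi> t) \<circ> \<xi> x t has_real_derivative \<Psi> (\<xi> x t r) t * (x - X0 t))
          (at r within {0..1})"
        by (rule DERIV_image_chain)
      then show "((\<lambda>r. y (\<xi> x t r) t) has_vector_derivative \<Psi> (\<xi> x t r) t * (x - X0 t))
          (at r within {0..1})"
        by (simp add: has_real_derivative_iff_has_vector_derivative o_def)
    qed simp
    then have "((\<lambda>r. \<Psi> (\<xi> x t r) t * (x - X0 t)) has_integral y x t) {0..1}"
      by (simp add: \<xi>_def y_X0 t)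
    then show ?thesis by (rule integral_unique[symmetric])
  qed
  have cX0: "continuous_on (closed_strip X0 X1 \<times> cbox 0 1) (\<lambda>p. X0 (snd (fst p)))"
    by (rule continuous_on_compose2[OF continuous_X0])
       (auto intro!: continuous_intros simp: closed_strip_iff)
  have "continuous_on (closed_strip X0 X1 \<times> cbox 0 1)
      (\<lambda>p. (\<lambda>(x, t). \<Psi> x t) (\<xi> (fst (fst p)) (snd (fst p)) (snd p), snd (fst p)))"
  proof (rule continuous_on_compose2[OF continuous_\<Psi>])
    show "continuous_on (closed_strip X0 X1 \<times> cbox 0 1)
        (\<lambda>p. (\<xi> (fst (fst p)) (snd (fst p)) (snd p), snd (fst p)))"
      unfolding \<xi>_def by (intro continuous_intros cX0)
    show "(\<lambda>p. (\<xi> (fst (fst p)) (snd (fst p)) (snd p), snd (fst p))) `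
        (closed_strip X0 X1 \<times> cbox 0 1) \<subseteq> closed_strip X0 X1"
    proof clarsimp
      fix x t r :: real
      assume xt: "(x, t) \<in> closed_strip X0 X1" and "0 \<le> r" "r \<le> 1"
      then show "(\<xi> x t r, t) \<in> closed_strip X0 X1"
        using mem[of t x r] by (auto simp: closed_strip_iff)
    qed
  qed
  then have "continuous_on (closed_strip X0 X1 \<times> cbox 0 1)
      (\<lambda>p. (\<lambda>(x, t). \<Psi> x t) (\<xi> (fst (fst p)) (snd (fst p)) (snd p), snd (fst p))
        * (fst (fst p) - X0 (snd (fst p))))"
    by (intro continuous_intros cX0)
  then have "continuous_on (closed_strip X0 X1 \<times> cbox 0 1)
      (\<lambda>(z, r). (case z of (x, t) \<Rightarrow> (\<lambda>r. \<Psi> (\<xi> x t r) t * (x - X0 t))) r)"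
    by (simp add: case_prod_unfold)
  then have "continuous_on (closed_strip X0 X1)
      (\<lambda>z. integral (cbox 0 1) (case z of (x, t) \<Rightarrow> (\<lambda>r. \<Psi> (\<xi> x t r) t * (x - X0 t))))"
    by (rule integral_continuous_on_param)
  then show ?thesis
    by (rule continuous_on_eq) (auto simp: y_eq)
qed

text \<open>
  On a compact time interval, \<open>(x, t) \<mapsto> (y(x, t), t)\<close> is a continuous injection of a compact
  set, hence a homeomorphism onto its image.
\<close>

lemma continuous_u: "continuous_on (closed_strip (\<lambda>_. 0) S) (\<lambda>(\<eta>, t). u \<eta> t)"
  unfolding continuous_on_eq_continuous_within
proof
  fix p assume p: "p \<in> closed_strip (\<lambda>_. 0) S"
  obtain \<eta>0 t0 where p_eq: "p = (\<eta>0, t0)" by (cases p)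
  have t0: "t0 > 0" "\<eta>0 \<in> closed_segment 0 (S t0)" using p by (auto simp: p_eq closed_strip_def)
  \<comment> \<open>A compact neighbourhood of \<open>t0\<close> that stays away from time
    0.\<close>
  define J where "J = {t0 / 2..2 * t0}"
  have J: "s > 0" if "s \<in> J" for s using that t0 by (auto simp: J_def)
  define K where "K = {(x, t). t \<in> J \<and> X0 t \<le> x \<and> x \<le> X1 t}"
  have K_strip: "K \<subseteq> closed_strip X0 X1" using J by (auto simp: K_def closed_strip_iff)
  \<comment> \<open>Linear interpolation between \<open>X0\<close> and \<open>X1\<close> presents
    \<open>K\<close> as the continuous image of a rectangle, which gives compactness.\<close>
  have "K = (\<lambda>(r, t). (X0 t + r * (X1 t - X0 t), t)) ` ({0..1} \<times> J)"
  proof (intro equalityI subsetI)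
    fix z assume "z \<in> K"
    then obtain x t where z: "z = (x, t)" and t: "t \<in> J" and x: "X0 t \<le> x" "x \<le> X1 t"
      by (auto simp: K_def)
    have lt: "X0 t < X1 t" using X0_less_X1 J t by auto
    have "z = (\<lambda>(r, t). (X0 t + r * (X1 t - X0 t), t)) ((x - X0 t) / (X1 t - X0 t), t)"
      using lt by (simp add: z)
    moreover have "(x - X0 t) / (X1 t - X0 t) \<in> {0..1}" using lt x by simp
    ultimately show "z \<in> (\<lambda>(r, t). (X0 t + r * (X1 t - X0 t), t)) ` ({0..1} \<times> J)"
      using t by blast
  next
    fix z assume "z \<in> (\<lambda>(r, t). (X0 t + r * (X1 t - X0 t), t)) ` ({0..1} \<times> J)"
    then obtain w where "w \<in> {0..1} \<times> J" and "z = (\<lambda>(r, t). (X0 t + r * (X1 t - X0 t), t)) w"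
      by blast
    moreover obtain r t where "w = (r, t)" by (cases w)
    ultimately have "(r, t) \<in> {0..1} \<times> J" and z: "z = (X0 t + r * (X1 t - X0 t), t)" by auto
    then have t: "t \<in> J" and r: "0 \<le> r" "r \<le> 1" by auto
    have "X0 t < X1 t" using X0_less_X1 J t by auto
    then have "0 \<le> r * (X1 t - X0 t)" "r * (X1 t - X0 t) \<le> X1 t - X0 t"
      using r by (auto simp: mult_left_le_one_le)
    then show "z \<in> K" using t by (auto simp: z K_def)
  qed
  moreover have "continuous_on ({0..1} \<times> J) (\<lambda>(r, t). (X0 t + r * (X1 t - X0 t), t))"
  proof -
    have "continuous_on ({0..1::real} \<times> J) (\<lambda>p. X0 (snd p))"
      "continuous_on ({0..1::real} \<times> J) (\<lambda>p. X1 (snd p))"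
      by (rule continuous_on_compose2[OF continuous_X0] continuous_on_compose2[OF continuous_X1];
          use J in \<open>auto intro!: continuous_intros\<close>)+
    then show ?thesis by (simp add: case_prod_unfold continuous_intros)
  qed
  ultimately have "compact K"
    by (simp add: compact_continuous_image compact_Times J_def)
  define G where "G = (\<lambda>(x, t). (y x t, t))"
  have "continuous_on K G"
    using continuous_on_subset[OF continuous_y K_strip]
    by (simp add: G_def case_prod_unfold continuous_intros)
  moreover have "(\<lambda>(\<eta>, t). (u \<eta> t, t)) (G z) = z" if "z \<in> K" for z
    using that J u_y by (auto simp: G_def K_def)
  ultimately have "continuous_on (G ` K) (\<lambda>(\<eta>, t). (u \<eta> t, t))"
    using \<open>compact K\<close> by (intro continuous_on_inv) auto
  then have "continuous_on (G ` K) (\<lambda>z. fst ((\<lambda>(\<eta>, t). (u \<eta> t, t)) z))"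
    by (rule continuous_on_fst)
  then have cu: "continuous_on (G ` K) (\<lambda>(\<eta>, t). u \<eta> t)"
    by (simp add: case_prod_unfold)
  have GK: "G ` K = {(\<eta>, t). t \<in> J \<and> \<eta> \<in> closed_segment 0 (S t)}"
  proof (intro equalityI subsetI)
    fix z assume "z \<in> G ` K"
    then obtain x t where "z = (y x t, t)" "t \<in> J" "x \<in> {X0 t..X1 t}"
      by (auto simp: G_def K_def)
    then show "z \<in> {(\<eta>, t). t \<in> J \<and> \<eta> \<in> closed_segment 0 (S t)}"
      using y_image(1)[of t] J by blast
  next
    fix z assume "z \<in> {(\<eta>, t). t \<in> J \<and> \<eta> \<in> closed_segment 0 (S t)}"
    then obtain \<eta> t where z: "z = (\<eta>, t)" and t: "t \<in> J" and \<eta>: "\<eta> \<in> closed_segment 0 (S t)" by auto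
    have "z = G (u \<eta> t, t)" using u_closed[OF J[OF t] \<eta>] by (simp add: z G_def)
    moreover have "(u \<eta> t, t) \<in> K" using u_closed[OF J[OF t] \<eta>] t by (simp add: K_def)
    ultimately show "z \<in> G ` K" by blast
  qed
  \<comment> \<open>Continuity at \<open>p\<close> is local: for times in the open interval around
    \<open>t0\<close>, the whole strip and the image of \<open>K\<close> under \<open>G\<close>
    coincide.\<close>
  have "at p within closed_strip (\<lambda>_. 0) S = at p within G ` K"
  proof (rule at_within_nhd)
    show "p \<in> UNIV \<times> {t0 / 2<..<2 * t0}" using t0 by (simp add: p_eq)
    show "open (UNIV \<times> {t0 / 2<..<2 * t0} :: (real \<times> real) set)" by (intro open_Times) auto
    show "closed_strip (\<lambda>_. 0) S \<inter> UNIV \<times> {t0 / 2<..<2 * t0} - {p} =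
        G ` K \<inter> UNIV \<times> {t0 / 2<..<2 * t0} - {p}"
      unfolding GK closed_strip_def J_def using t0(1) by auto
  qed
  moreover have "p \<in> G ` K" using t0 by (simp add: GK J_def p_eq)
  then have "continuous (at p within G ` K) (\<lambda>(\<eta>, t). u \<eta> t)"
    using cu unfolding continuous_on_eq_continuous_within by blast
  ultimately show "continuous (at p within closed_strip (\<lambda>_. 0) S) (\<lambda>(\<eta>, t). u \<eta> t)" by simp
qed

text \<open>Supplies the continuity of \<open>uy\<close> and \<open>ut\<close> in the final problem,
  since both are expressions in \<open>\<Psi>\<close> and \<open>F\<close> evaluated along
  \<open>u\<close>.\<close>

lemma continuous_comp_u:
  assumes "continuous_on (closed_strip X0 X1) (\<lambda>(x, t). f x t)"
  shows "continuous_on (closed_strip (\<lambda>_. 0) S) (\<lambda>(\<eta>, t). f (u \<eta> t) t)"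
proof -
  have "continuous_on (closed_strip (\<lambda>_. 0) S) (\<lambda>p. (\<lambda>(x, t). f x t) ((\<lambda>(\<eta>, t). u \<eta> t) p, snd p))"
  proof (rule continuous_on_compose2[OF assms])
    show "continuous_on (closed_strip (\<lambda>_. 0) S) (\<lambda>p. ((\<lambda>(\<eta>, t). u \<eta> t) p, snd p))"
      by (intro continuous_intros continuous_u)
    show "(\<lambda>p. ((\<lambda>(\<eta>, t). u \<eta> t) p, snd p)) ` closed_strip (\<lambda>_. 0) S \<subseteq> closed_strip X0 X1"
      using u_closed by (force simp: closed_strip_def[of "\<lambda>_. 0"] closed_strip_iff)
  qed
  then show ?thesis by (simp add: case_prod_unfold)
qed

section \<open>Derivatives of the inverse function\<close>

lemma u_slice_continuous:
  assumes "t > 0"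
  shows "continuous_on (closed_segment 0 (S t)) (\<lambda>\<eta>. u \<eta> t)"
proof -
  have "continuous_on (closed_segment 0 (S t)) (\<lambda>\<eta>. (\<lambda>(\<eta>, t). u \<eta> t) (\<eta>, t))"
    using assms by (intro continuous_on_compose2[OF continuous_u])
      (auto intro!: continuous_intros simp: closed_strip_def)
  then show ?thesis by simp
qed

text \<open>The derivative rule for an inverse function, taken within the image of the slice so that
  it also yields the one-sided derivatives at 0 and \<open>S t\<close>.\<close>

lemma u_has_space_derivative:
  assumes t: "t > 0" and \<eta>: "\<eta> \<in> closed_segment 0 (S t)"
  shows "((\<lambda>\<eta>. u \<eta> t) has_real_derivative 1 / \<Psi> (u \<eta> t) t) (at \<eta> within closed_segment 0 (S t))"
proof -
  note u = u_closed[OF t \<eta>]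
  have "((\<lambda>\<eta>. u \<eta> t) has_derivative (*) (1 / \<Psi> (u \<eta> t) t))
      (at (y (u \<eta> t) t) within (\<lambda>x. y x t) ` {X0 t..X1 t})"
  proof (rule has_derivative_inverse_within)
    show "((\<lambda>x. y x t) has_derivative (*) (\<Psi> (u \<eta> t) t)) (at (u \<eta> t) within {X0 t..X1 t})"
      using deriv_y_space[OF t u(1)] by (simp add: has_field_derivative_def)
    show "continuous (at (y (u \<eta> t) t) within (\<lambda>x. y x t) ` {X0 t..X1 t}) (\<lambda>\<eta>. u \<eta> t)"
      using u_slice_continuous[OF t] \<eta> u(2)
      by (simp add: y_image[OF t] continuous_on_eq_continuous_within)
    show "(*) (1 / \<Psi> (u \<eta> t) t) \<circ> (*) (\<Psi> (u \<eta> t) t) = id"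
      using \<Psi>_nonzero[OF t u(1)] by auto
    show "linear ((*) (1 / \<Psi> (u \<eta> t) t))" by (rule linear_times)
  qed (use u u_y[OF t] in auto)
  then show ?thesis by (simp add: y_image[OF t] u(2) has_field_derivative_def)
qed

lemma u_has_space_derivative_interior:
  assumes t: "t > 0" and \<eta>: "\<eta> \<in> open_segment 0 (S t)"
  shows "((\<lambda>\<eta>. u \<eta> t) has_real_derivative 1 / \<Psi> (u \<eta> t) t) (at \<eta>)"
proof -
  have "\<eta> \<in> interior (closed_segment 0 (S t))"
    using \<eta> by (auto simp: closed_segment_eq_real_ivl open_segment_eq_real_ivl split: if_splits)
  then have "(at \<eta> within closed_segment 0 (S t)) = at \<eta>" by (rule at_within_interior)
  moreover have "\<eta> \<in> closed_segment 0 (S t)" using \<eta> segment_open_subset_closed by blast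
  note u_has_space_derivative[OF t this]
  ultimately show ?thesis by simp
qed

lemma u_has_second_space_derivative:
  assumes t: "t > 0" and \<eta>: "\<eta> \<in> open_segment 0 (S t)"
  shows "((\<lambda>\<eta>. 1 / \<Psi> (u \<eta> t) t) has_real_derivative - \<Psi>x (u \<eta> t) t / \<Psi> (u \<eta> t) t ^ 3) (at \<eta>)"
proof -
  note u = u_open[OF t \<eta>]
  have nz: "\<Psi> (u \<eta> t) t \<noteq> 0" using \<Psi>_nonzero[OF t] u by auto
  have "((\<lambda>\<xi>. \<Psi> \<xi> t) has_real_derivative \<Psi>x (u \<eta> t) t) (at (u \<eta> t))"
    using deriv_\<Psi>_space[OF t, of "u \<eta> t"] u at_within_Icc_at[of "X0 t" "u \<eta> t" "X1 t"] by simp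
  from DERIV_chain2[OF this u_has_space_derivative_interior[OF t \<eta>]]
  have "((\<lambda>\<eta>. \<Psi> (u \<eta> t) t) has_real_derivative \<Psi>x (u \<eta> t) t * (1 / \<Psi> (u \<eta> t) t)) (at \<eta>)" .
  from DERIV_divide[OF DERIV_const[of 1] this nz] show ?thesis
    by (simp add: nz field_simps power3_eq_cube)
qed

text \<open>Implicit differentiation of \<open>y (u \<eta> s) s = \<eta>\<close> by hand. With
  \<open>x0 = u \<eta> t\<close>, the mean value theorem in space at time \<open>s\<close> gives
  \<open>\<eta> - y x0 s = \<Psi> \<xi> s * (u \<eta> s - x0)\<close>. Dividing by
  \<open>s - t\<close> leaves the known time derivative of \<open>y\<close> at the fixed point
  \<open>x0\<close>.\<close>

lemma u_has_time_derivative: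
  assumes t: "t > 0" and \<eta>: "\<eta> \<in> open_segment 0 (S t)"
  shows "((\<lambda>s. u \<eta> s) has_real_derivative - F (u \<eta> t) t / \<Psi> (u \<eta> t) t) (at t)"
proof -
  define x0 where "x0 = u \<eta> t"
  have x0: "X0 t < x0" "x0 < X1 t" "y x0 t = \<eta>" using u_open[OF t \<eta>] by (auto simp: x0_def)
  have cont: "isCont X0 t" "isCont X1 t" "isCont S t"
    using DERIV_isCont deriv_X0[OF t] deriv_X1[OF t] S_has_derivative[OF t] by blast+
  have "\<forall>\<^sub>F s in at t. s > 0"
    using t by (intro order_tendstoD(1)[OF tendsto_ident_at])
  moreover have "\<forall>\<^sub>F s in at t. X0 s < x0" "\<forall>\<^sub>F s in at t. x0 < X1 s"
    using cont x0 by (auto simp: isCont_def intro: order_tendstoD)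
  \<comment> \<open>\<open>S t\<close> may have either sign, but it is not 0 because
    \<open>\<eta>\<close> lies strictly between 0 and \<open>S t\<close>. Continuity of
    \<open>S\<close> settles each case.\<close>
  moreover have "\<forall>\<^sub>F s in at t. \<eta> \<in> open_segment 0 (S s)"
  proof (cases "S t > 0")
    case True
    then have "0 < \<eta>" "\<eta> < S t" using \<eta> by (auto simp: open_segment_eq_real_ivl)
    moreover have "\<forall>\<^sub>F s in at t. \<eta> < S s"
      using cont(3) \<open>\<eta> < S t\<close> by (auto simp: isCont_def intro: order_tendstoD)
    ultimately show ?thesis
      by (auto elim!: eventually_mono simp: open_segment_eq_real_ivl)
  next
    case False
    then have "\<eta> < 0" "S t < \<eta>" using \<eta> by (auto simp: open_segment_eq_real_ivl split: if_splits)
    moreover have "\<forall>\<^sub>F s in at t. S s < \<eta>"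
      using cont(3) \<open>S t < \<eta>\<close> by (auto simp: isCont_def intro: order_tendstoD)
    ultimately show ?thesis
      by (auto elim!: eventually_mono simp: open_segment_eq_real_ivl)
  qed
  ultimately have near:
    "\<forall>\<^sub>F s in at t. s > 0 \<and> X0 s < x0 \<and> x0 < X1 s \<and> \<eta> \<in> open_segment 0 (S s)"
    by eventually_elim simp
  have "\<forall>\<^sub>F s in at t. \<exists>\<xi>. (\<xi>, s) \<in> closed_strip X0 X1 \<and> \<xi> \<in> closed_segment x0 (u \<eta> s) \<and>
      \<eta> - y x0 s = \<Psi> \<xi> s * (u \<eta> s - x0)"
    using near
  proof eventually_elim
    case (elim s)
    then have s: "s > 0" and \<eta>s: "\<eta> \<in> open_segment 0 (S s)" by auto
    note us = u_open[OF s \<eta>s]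
    have sub: "closed_segment x0 (u \<eta> s) \<subseteq> {X0 s..X1 s}"
      using elim us by (auto simp: closed_segment_eq_real_ivl split: if_splits)
    have d: "((\<lambda>x. y x s) has_derivative (*) (\<Psi> x s)) (at x within closed_segment x0 (u \<eta> s))"
      if "x \<in> closed_segment x0 (u \<eta> s)" for x
      using DERIV_subset[OF deriv_y_space[OF s] sub] that sub
      by (auto simp: has_field_derivative_def)
    obtain \<xi> where \<xi>: "\<xi> \<in> closed_segment x0 (u \<eta> s)" "\<eta> - y x0 s = \<Psi> \<xi> s * (u \<eta> s - x0)"
    proof (cases x0 "u \<eta> s" rule: linorder_cases)
      case less
      then have *: "closed_segment x0 (u \<eta> s) = {x0..u \<eta> s}" by (simp add: closed_segment_eq_real_ivl)
      have "\<exists>x\<in>{x0<..<u \<eta> s}. y (u \<eta> s) s - y x0 s = \<Psi> x s * (u \<eta> s - x0)"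
        using d by (intro mvt_simple[OF less]) (auto simp: *)
      then obtain x where "x \<in> {x0<..<u \<eta> s}" "y (u \<eta> s) s - y x0 s = \<Psi> x s * (u \<eta> s - x0)"
        by blast
      then show thesis using us by (intro that[of x]) (auto simp: *)
    next
      case equal
      then show thesis using us by (intro that[of x0]) auto
    next
      case greater
      then have *: "closed_segment x0 (u \<eta> s) = {u \<eta> s..x0}" by (simp add: closed_segment_eq_real_ivl)
      have "\<exists>x\<in>{u \<eta> s<..<x0}. y x0 s - y (u \<eta> s) s = \<Psi> x s * (x0 - u \<eta> s)"
        using d by (intro mvt_simple[OF greater]) (auto simp: *)
      then obtain x where "x \<in> {u \<eta> s<..<x0}" "y x0 s - y (u \<eta> s) s = \<Psi> x s * (x0 - u \<eta> s)"
        by blast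
      then show thesis using us by (intro that[of x]) (auto simp: * algebra_simps)
    qed
    moreover have "(\<xi>, s) \<in> closed_strip X0 X1" using \<xi>(1) sub s by (auto simp: closed_strip_iff)
    ultimately show ?case by blast
  qed
  then obtain \<xi> where \<xi>: "\<forall>\<^sub>F s in at t. (\<xi> s, s) \<in> closed_strip X0 X1 \<and>
      \<xi> s \<in> closed_segment x0 (u \<eta> s) \<and> \<eta> - y x0 s = \<Psi> (\<xi> s) s * (u \<eta> s - x0)"
    unfolding eventually_ex by blast
  have "(\<eta>, t) \<in> closed_strip (\<lambda>_. 0) S"
    using t \<eta> segment_open_subset_closed by (auto simp: closed_strip_def)
  moreover have "\<forall>\<^sub>F s in at t. (\<eta>, s) \<in> closed_strip (\<lambda>_. 0) S"
    using near segment_open_subset_closed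
    by (auto elim!: eventually_mono simp: closed_strip_def)
  ultimately have "((\<lambda>s. (\<lambda>(\<eta>, t). u \<eta> t) (\<eta>, s)) \<longlongrightarrow> (\<lambda>(\<eta>, t). u \<eta> t) (\<eta>, t)) (at t)"
    by (intro continuous_on_tendsto_compose[OF continuous_u]
        tendsto_Pair tendsto_const tendsto_ident_at)
  then have ulim: "((\<lambda>s. u \<eta> s) \<longlongrightarrow> x0) (at t)" by (simp add: x0_def)
  \<comment> \<open>\<open>\<xi> s\<close> lies between \<open>x0\<close> and
    \<open>u \<eta> s\<close>, and the latter tends to \<open>x0\<close> by the joint continuity of
    \<open>u\<close>.\<close>
  have "(\<xi> \<longlongrightarrow> x0) (at t)"
  proof (rule metric_tendsto_imp_tendsto[OF ulim])
    show "\<forall>\<^sub>F s in at t. dist (\<xi> s) x0 \<le> dist (u \<eta> s) x0"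
      using \<xi> by eventually_elim (metis dist_in_closed_segment dist_commute)
  qed
  then have "((\<lambda>s. (\<lambda>(x, t). \<Psi> x t) (\<xi> s, s)) \<longlongrightarrow> (\<lambda>(x, t). \<Psi> x t) (x0, t)) (at t)"
    by (intro continuous_on_tendsto_compose[OF continuous_\<Psi>] tendsto_Pair tendsto_ident_at)
       (use \<xi> x0 t in \<open>auto simp: closed_strip_iff elim: eventually_mono\<close>)
  then have "((\<lambda>s. \<Psi> (\<xi> s) s) \<longlongrightarrow> \<Psi> x0 t) (at t)" by simp
  moreover have "((\<lambda>s. (y x0 s - y x0 t) / (s - t)) \<longlongrightarrow> F x0 t) (at t)"
    using deriv_y_time[OF t x0(1,2)] by (simp add: has_field_derivative_iff)
  moreover have nz: "\<Psi> x0 t \<noteq> 0" using \<Psi>_nonzero[OF t] x0 by auto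
  ultimately have "((\<lambda>s. - ((y x0 s - y x0 t) / (s - t)) / \<Psi> (\<xi> s) s) \<longlongrightarrow> - F x0 t / \<Psi> x0 t) (at t)"
    by (intro tendsto_divide tendsto_minus)
  moreover have "\<forall>\<^sub>F s in at t. - ((y x0 s - y x0 t) / (s - t)) / \<Psi> (\<xi> s) s =
      (u \<eta> s - u \<eta> t) / (s - t)"
    using \<xi>
  proof eventually_elim
    case (elim s)
    then have "\<Psi> (\<xi> s) s \<noteq> 0" using \<Psi>_nonzero[of s "\<xi> s"] by (auto simp: closed_strip_iff)
    then have "u \<eta> s - u \<eta> t = - (y x0 s - y x0 t) / \<Psi> (\<xi> s) s"
      using elim x0(3) by (simp add: x0_def field_simps)
    then show ?case by (simp add: minus_divide_left mult.commute)
  qed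
  ultimately have "((\<lambda>s. (u \<eta> s - u \<eta> t) / (s - t)) \<longlongrightarrow> - F x0 t / \<Psi> x0 t) (at t)"
    by (rule Lim_transform_eventually)
  then show ?thesis by (simp add: has_field_derivative_iff x0_def)
qed

text \<open>Substitution of \<open>y x t\<close> for the integration variable, with
  \<open>u (y x t) t = x\<close>. The minus sign comes from integrating from \<open>S t\<close> down
  to 0.\<close>

lemma interval_integral_u:
  assumes t: "t > 0"
  shows "(LBINT \<sigma>=S t..0. u \<sigma> t) = - integral {X0 t..X1 t} (\<lambda>\<sigma>. \<sigma> * \<Psi> \<sigma> t)"
proof -
  have "(LBINT x=X0 t..X1 t. \<Psi> x t *\<^sub>R u (y x t) t) = (LBINT \<eta>=y (X0 t) t..y (X1 t) t. u \<eta> t)"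
    using X0_less_X1[OF t] deriv_y_space[OF t] u_slice_continuous[OF t]
      continuous_slice[OF continuous_\<Psi> t]
    by (intro interval_integral_substitution_finite) (auto simp: y_image[OF t])
  moreover have "(LBINT x=X0 t..X1 t. \<Psi> x t *\<^sub>R u (y x t) t) =
      integral {X0 t..X1 t} (\<lambda>x. \<Psi> x t *\<^sub>R u (y x t) t)"
  proof (rule interval_integral_eq_integral)
    have "continuous_on {X0 t..X1 t} (\<lambda>x. u (y x t) t)"
      by (rule continuous_on_eq[OF continuous_on_id]) (use u_y[OF t] in auto)
    then show "set_integrable lborel {X0 t..X1 t} (\<lambda>x. \<Psi> x t *\<^sub>R u (y x t) t)"
      using continuous_slice[OF continuous_\<Psi> t]
      by (intro borel_integrable_atLeastAtMost') (auto intro!: continuous_intros)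
  qed (use X0_less_X1[OF t] in simp)
  moreover have "integral {X0 t..X1 t} (\<lambda>x. \<Psi> x t *\<^sub>R u (y x t) t) =
      integral {X0 t..X1 t} (\<lambda>\<sigma>. \<sigma> * \<Psi> \<sigma> t)"
    by (rule Henstock_Kurzweil_Integration.integral_cong) (use u_y[OF t] in auto)
  ultimately show ?thesis
    using interval_integral_endpoints_reverse[of "ereal (S t)" 0 "\<lambda>\<sigma>. u \<sigma> t"]
    by (simp add: y_X0 y_X1 t zero_ereal_def)
qed

end

section \<open>The transformed problem\<close>

text \<open>A bootstrap for \<open>X0\<close>: as an indefinite integral it is continuous, hence its
  integrand is continuous for positive times, hence \<open>X0\<close> is differentiable
  there.\<close>

lemma psi_problem_imp_psi_solution:
  assumes "psi_problem \<delta> q L Tm C \<Psi> \<Psi>x X0 X1"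
  obtains \<Psi>t where "psi_solution \<delta> \<Psi> \<Psi>x \<Psi>t X0 X1"
proof -
  have eq: "psi_equation \<delta> \<Psi> \<Psi>x X0 X1" using assms by (simp add: psi_problem_def)
  define g where
    "g = (\<lambda>\<tau>. \<Psi>x (X0 \<tau>) \<tau> / \<Psi> (X0 \<tau>) \<tau> ^ 3 + 2 * \<delta> * (X0 \<tau> / \<Psi> (X0 \<tau>) \<tau>))"
  have g: "g integrable_on {0..t}" "X0 t = - integral {0..t} g" if "t > 0" for t
    using assms that by (auto simp: psi_problem_def g_def)
  have less: "X0 t < X1 t" if "t > 0" for t
    using eq that by (auto simp: psi_equation_def)
  have nz: "\<Psi> x t \<noteq> 0" if "t > 0" "x \<in> {X0 t..X1 t}" for x t
    using eq that by (auto simp: psi_equation_def)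
  have cont: "continuous_on (closed_strip X0 X1) (\<lambda>(x, t). \<Psi> x t)"
    "continuous_on (closed_strip X0 X1) (\<lambda>(x, t). \<Psi>x x t)"
    using eq by (auto simp: psi_equation_def)
  have X0_eq: "(- integral {0..s} g) = X0 s" if "s \<in> {0<..<2 * t}" for s t
    using g that by simp
  have "isCont X0 t" if t: "t > 0" for t
  proof -
    \<comment> \<open>Integrating up to \<open>2 * t\<close> makes \<open>t\<close> an interior
      point.\<close>
    have "continuous_on {0<..<2 * t} (\<lambda>s. - integral {0..s} g)"
      using indefinite_integral_continuous_1[OF g(1)[of "2 * t"]] t
      by (intro continuous_on_minus) (auto elim: continuous_on_subset)
    then have "continuous_on {0<..<2 * t} X0"
      by (rule continuous_on_eq) (use X0_eq in auto)
    then show ?thesis using t by (simp add: continuous_on_eq_continuous_at)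
  qed
  then have cX0: "continuous_on {0<..} X0" by (auto intro: continuous_at_imp_continuous_on)
  have on_X0: "continuous_on {0<..} (\<lambda>t. f (X0 t) t)"
    if "continuous_on (closed_strip X0 X1) (\<lambda>(x, t). f x t)" for f :: "real \<Rightarrow> real \<Rightarrow> real"
  proof -
    have "continuous_on {0<..} (\<lambda>t. (\<lambda>(x, t). f x t) (X0 t, t))"
      by (rule continuous_on_compose2[OF that])
         (auto simp: closed_strip_def intro!: continuous_intros cX0)
    then show ?thesis by simp
  qed
  have nz0: "\<Psi> (X0 t) t \<noteq> 0" if "t > 0" for t using nz[OF that, of "X0 t"] less[OF that] by simp
  have "continuous_on {0<..} g"
    unfolding g_def by (intro continuous_intros on_X0 cont cX0) (auto simp: nz0)
  then have cg: "isCont g t" if "t > 0" for t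
    using that by (simp add: continuous_on_eq_continuous_at)
  have "(X0 has_real_derivative - psi_flux \<delta> \<Psi> \<Psi>x (X0 t) t / \<Psi> (X0 t) t) (at t)" if t: "t > 0" for t
  proof -
    have "((\<lambda>s. integral {0..s} g) has_vector_derivative g t) (at t within ({0..2 * t} - {}))"
      using t cg[OF t] g(1)[of "2 * t"]
      by (intro integral_has_vector_derivative_continuous_at) (auto intro: continuous_at_imp_continuous_at_within)
    then have "((\<lambda>s. integral {0..s} g) has_real_derivative g t) (at t)"
      using t at_within_Icc_at[of 0 t "2 * t"]
      by (simp add: has_real_derivative_iff_has_vector_derivative)
    from DERIV_minus[OF this] have "((\<lambda>s. - integral {0..s} g) has_real_derivative - g t) (at t)" .
    then have "(X0 has_real_derivative - g t) (at t)"
      by (rule has_field_derivative_transform_within_open[where S = "{0<..<2 * t}"])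
         (use t X0_eq in auto)
    \<comment> \<open>Along \<open>X0\<close> the integrand is the flux divided by
      \<open>\<Psi>\<close>.\<close>
    moreover have "- g t = - psi_flux \<delta> \<Psi> \<Psi>x (X0 t) t / \<Psi> (X0 t) t"
      using nz0[OF t] by (simp add: g_def psi_flux_def field_simps power2_eq_square power3_eq_cube)
    ultimately show ?thesis by simp
  qed
  moreover obtain \<Psi>t Fx where
    "continuous_on (open_strip X0 X1) (\<lambda>(x, t). \<Psi>t x t)"
    and time: "\<And>t x. t > 0 \<Longrightarrow> X0 t < x \<Longrightarrow> x < X1 t \<Longrightarrow>
       ((\<lambda>s. \<Psi> x s) has_real_derivative \<Psi>t x t) (at t)"
    and Fx: "\<And>t x. t > 0 \<Longrightarrow> X0 t < x \<Longrightarrow> x < X1 t \<Longrightarrow>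
       ((\<lambda>\<xi>. \<Psi>x \<xi> t / (\<Psi> \<xi> t)\<^sup>2) has_real_derivative Fx x t) (at x)"
       "\<And>t x. t > 0 \<Longrightarrow> X0 t < x \<Longrightarrow> x < X1 t \<Longrightarrow> \<Psi>t x t = Fx x t + 2 * \<delta>"
    using eq unfolding psi_equation_def by blast
  \<comment> \<open>The linear term of the flux absorbs the source \<open>2 * \<delta>\<close> of
    the equation.\<close>
  moreover have "((\<lambda>\<xi>. psi_flux \<delta> \<Psi> \<Psi>x \<xi> t) has_real_derivative \<Psi>t x t) (at x)"
    if "t > 0" "X0 t < x" "x < X1 t" for t x
    unfolding psi_flux_def
    by (rule derivative_eq_intros Fx(1)[OF that] refl)+ (simp add: Fx(2)[OF that])
  moreover have "(X1 has_real_derivative deriv X1 t) (at t)" if "t > 0" for t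
    using assms that by (auto simp: psi_problem_def field_differentiable_derivI)
  moreover have "((\<lambda>\<xi>. \<Psi> \<xi> t) has_real_derivative \<Psi>x x t) (at x within {X0 t..X1 t})"
    if "t > 0" "x \<in> {X0 t..X1 t}" for x t
    using eq that by (auto simp: psi_equation_def)
  ultimately have "psi_solution \<delta> \<Psi> \<Psi>x \<Psi>t X0 X1"
    using less cont nz by unfold_locales auto
  then show thesis by (rule that)
qed

text \<open>\<open>H_fun\<close> is the time derivative of \<open>- \<delta>\<close> times the first
  moment, and the limit clause of \<open>psi_width\<close> makes the contribution at time 0
  vanish.\<close>

lemma integral_H_fun_eq_moment:
  assumes \<delta>: "\<delta> > 0"
    and prob: "psi_problem \<delta> q L Tm C \<Psi> \<Psi>x X0 X1"
    and width: "psi_width \<Psi> X0 X1 S"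
    and t: "t > 0"
  shows "integral {0..t} (H_fun \<delta> L Tm C \<Psi> X0 X1) =
    - \<delta> * integral {X0 t..X1 t} (\<lambda>\<sigma>. \<sigma> * \<Psi> \<sigma> t)"
proof -
  obtain \<Psi>t where "psi_solution \<delta> \<Psi> \<Psi>x \<Psi>t X0 X1"
    using psi_problem_imp_psi_solution[OF prob] .
  then interpret psi_solution \<delta> \<Psi> \<Psi>x \<Psi>t X0 X1 .
  define M where "M = (\<lambda>s. integral {X0 s..X1 s} (\<lambda>\<sigma>. \<sigma> * \<Psi> \<sigma> s))"
  \<comment> \<open>The value at 0 is set to the limit, since the assumptions do not control the
    moment integral at time 0 itself.\<close>
  define N where "N = (\<lambda>s. if s = 0 then 0 else - \<delta> * M s)"
  have dM: "((\<lambda>s. - \<delta> * M s) has_real_derivative H_fun \<delta> L Tm C \<Psi> X0 X1 s) (at s)" if s: "s > 0" for s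
  proof -
    define W where "W = \<Psi> (X1 s) s * deriv X1 s + F (X1 s) s"
    have L: "L s \<noteq> 0" and C: "C s > 0"
      using prob s by (simp_all add: psi_problem_def)
    have X1: "X1 s = Tm s / (\<delta> * C s)"
      using prob s unfolding psi_problem_def by blast
    have i: "1 / \<Psi> (X1 s) s - \<delta> * (X1 s)\<^sup>2 = - (L s / (\<delta> * C s)) * W"
      using prob s unfolding psi_problem_def W_def by blast
    have Tm: "Tm s = \<delta> * C s * X1 s" using X1 C \<delta> by simp
    \<comment> \<open>Condition (i) solved for the velocity \<open>W\<close> of the free boundary.
      With \<open>Tm\<close> also expressed through \<open>X1\<close>, the comparison with
      \<open>H_fun\<close> becomes an algebraic identity.\<close>
    have W: "W = - (\<delta> * C s / L s) * (1 / \<Psi> (X1 s) s - \<delta> * (X1 s)\<^sup>2)"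
      unfolding i using L C \<delta> by simp
    define p0 p1 where "p0 = 1 / \<Psi> (X0 s) s" and "p1 = 1 / \<Psi> (X1 s) s"
    have H: "H_fun \<delta> L Tm C \<Psi> X0 X1 s = - (Tm s ^ 3 / (L s * (C s)\<^sup>2)) + \<delta> * (Tm s / L s) * p1
       - \<delta> * p1 + (Tm s)\<^sup>2 / (C s)\<^sup>2 + \<delta> * p0 - \<delta>\<^sup>2 * (X0 s)\<^sup>2"
      by (simp add: H_fun_def p0_def p1_def)
    have "- \<delta> * (X1 s * W + (p1 - \<delta> * (X1 s)\<^sup>2) - (p0 - \<delta> * (X0 s)\<^sup>2)) =
        H_fun \<delta> L Tm C \<Psi> X0 X1 s"
      unfolding H W p1_def[symmetric] Tm using L C
      by (simp add: field_simps power2_eq_square power3_eq_cube)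
    moreover have "((\<lambda>s. - \<delta> * M s) has_real_derivative
        - \<delta> * (X1 s * W + (p1 - \<delta> * (X1 s)\<^sup>2) - (p0 - \<delta> * (X0 s)\<^sup>2))) (at s)"
      unfolding M_def W_def p0_def p1_def by (rule DERIV_cmult[OF moment_has_derivative[OF s]])
    ultimately show ?thesis by simp
  qed
  have dN: "(N has_real_derivative H_fun \<delta> L Tm C \<Psi> X0 X1 s) (at s)" if "s > 0" for s
    by (rule has_field_derivative_transform_within_open[OF dM[OF that], where S = "{0<..}"])
       (use that in \<open>auto simp: N_def\<close>)
  have "(M \<longlongrightarrow> 0) (at_right 0)" using width by (simp add: psi_width_def M_def)
  from tendsto_mult[OF tendsto_const[of "- \<delta>"] this]
  have "((\<lambda>s. - \<delta> * M s) \<longlongrightarrow> 0) (at_right 0)" by simp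
  then have "(N \<longlongrightarrow> 0) (at_right 0)"
    by (rule Lim_transform_eventually)
       (auto simp: N_def eventually_at_filter intro!: always_eventually)
  then have N0: "(N \<longlongrightarrow> N 0) (at_right 0)" by (simp add: N_def)
  \<comment> \<open>\<open>H_fun\<close> may be singular at 0, so this version asks for derivatives
    only inside the interval and for continuity of \<open>N\<close> up to its ends.\<close>
  have "(H_fun \<delta> L Tm C \<Psi> X0 X1 has_integral N t - N 0) {0..t}"
  proof (rule fundamental_theorem_of_calculus_interior)
    show "continuous_on {0..t} N"
      unfolding continuous_on_def
    proof
      fix s assume s: "s \<in> {0..t}"
      show "(N \<longlongrightarrow> N s) (at s within {0..t})"
      proof (cases "s = 0")
        case True
        then show ?thesis using N0 t by (simp add: at_within_Icc_at_right)
      next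
        case False
        then have "isCont N s" using s by (intro DERIV_isCont[OF dN]) auto
        then have "continuous (at s within {0..t}) N"
          by (rule continuous_at_imp_continuous_at_within)
        then show ?thesis by (simp add: continuous_within)
      qed
    qed
    show "(N has_vector_derivative H_fun \<delta> L Tm C \<Psi> X0 X1 s) (at s)" if "s \<in> {0<..<t}" for s
      using dN[of s] that by (simp add: has_real_derivative_iff_has_vector_derivative)
  qed (use t in simp)
  then have "integral {0..t} (H_fun \<delta> L Tm C \<Psi> X0 X1) = N t - N 0" by (rule integral_unique)
  then show ?thesis using t by (simp add: N_def M_def)
qed

text \<open>Existence accompanies the universal claim so that the latter is not vacuous. The claim
  covers every admissible pair, whatever values \<open>u\<close> takes outside the image of
  \<open>y\<close>.\<close>

theorem theorem3p2:
  fixes \<delta> q :: real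
    and L Tm C X0 X1 S :: "real \<Rightarrow> real"
    and \<Psi> \<Psi>x :: "real \<Rightarrow> real \<Rightarrow> real"
  assumes "\<delta> > 0" and "q > 0"
    and "psi_problem \<delta> q L Tm C \<Psi> \<Psi>x X0 X1"
    and "psi_width \<Psi> X0 X1 S"
  shows "(\<exists>y u. reciprocal_transformation \<delta> \<Psi> \<Psi>x X0 X1 y u) \<and>
         (\<forall>y u. reciprocal_transformation \<delta> \<Psi> \<Psi>x X0 X1 y u \<longrightarrow>
            burgers_problem \<delta> q L Tm C u S)"
proof (intro conjI allI impI)
  obtain \<Psi>t where sol: "psi_solution \<delta> \<Psi> \<Psi>x \<Psi>t X0 X1"
    using psi_problem_imp_psi_solution[OF assms(3)] .
  then show "\<exists>y u. reciprocal_transformation \<delta> \<Psi> \<Psi>x X0 X1 y u"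
    by (rule psi_solution.reciprocal_transformation_exists)
  fix y u assume rec: "reciprocal_transformation \<delta> \<Psi> \<Psi>x X0 X1 y u"
  interpret psi_reciprocal \<delta> \<Psi> \<Psi>x \<Psi>t X0 X1 S y u
    using sol rec assms(4)
    by (simp add: psi_reciprocal_def psi_reciprocal_axioms_def psi_width_def)
  \<comment> \<open>The witnesses come from differentiating the inverse function.\<close>
  define uy uyy ut where "uy = (\<lambda>\<eta> t. 1 / \<Psi> (u \<eta> t) t)"
    and "uyy = (\<lambda>\<eta> t. - \<Psi>x (u \<eta> t) t / \<Psi> (u \<eta> t) t ^ 3)"
    and "ut = (\<lambda>\<eta> t. - F (u \<eta> t) t / \<Psi> (u \<eta> t) t)"
  have strip_sub: "open_strip (\<lambda>_. 0) S \<subseteq> closed_strip (\<lambda>_. 0) S"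
    using segment_open_subset_closed by (fastforce simp: open_strip_def closed_strip_def)
  have "continuous_on (closed_strip X0 X1) (\<lambda>(x, t). - F x t / \<Psi> x t)"
    using continuous_\<Psi> continuous_flux \<Psi>_nonzero
    by (auto simp: case_prod_unfold closed_strip_iff intro!: continuous_intros)
  from continuous_on_subset[OF continuous_comp_u[OF this] strip_sub]
  have cut: "continuous_on (open_strip (\<lambda>_. 0) S) (\<lambda>(y, t). ut y t)" by (simp add: ut_def)
  have "continuous_on (closed_strip X0 X1) (\<lambda>(x, t). 1 / \<Psi> x t)"
    using continuous_\<Psi> \<Psi>_nonzero
    by (auto simp: case_prod_unfold closed_strip_iff intro!: continuous_intros)
  from continuous_comp_u[OF this]
  have cuy: "continuous_on (closed_strip (\<lambda>_. 0) S) (\<lambda>(y, t). uy y t)" by (simp add: uy_def)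
  show "burgers_problem \<delta> q L Tm C u S"
    unfolding burgers_problem_def
  proof (rule exI[of _ uy], rule exI[of _ uyy], rule exI[of _ ut],
      intro conjI allI impI ballI continuous_u cut cuy)
    fix t :: real assume t: "t > 0"
    have dS: "deriv S t = \<Psi> (X1 t) t * deriv X1 t + F (X1 t) t"
      using S_has_derivative[OF t] by (rule DERIV_imp_deriv)
    show "C field_differentiable at t" using assms(3) t by (simp add: psi_problem_def)
    show "S field_differentiable at t"
      using S_has_derivative[OF t] by (auto simp: field_differentiable_def)
    show "deriv C t = (L t - Tm t) * deriv S t"
      using assms(3) t unfolding dS by (simp add: psi_problem_def)
    have "1 / \<Psi> (X1 t) t - \<delta> * (X1 t)\<^sup>2 = - (L t / (\<delta> * C t)) * deriv S t"
      using assms(3) t unfolding dS psi_problem_def by blast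
    then show "uy (S t) t - \<delta> * (u (S t) t)\<^sup>2 = - (L t * deriv S t / (\<delta> * C t))"
      by (simp add: uy_def u_ends t)
    show "u (S t) t = Tm t / (\<delta> * C t)"
      using assms(3) t by (simp add: u_ends psi_problem_def)
    have "1 / \<Psi> (X0 t) t - \<delta> * (X0 t)\<^sup>2 =
        - q * exp (integral {0..t} (H_fun \<delta> L Tm C \<Psi> X0 X1)) / (\<delta> * C t)"
      using assms(3) t unfolding psi_problem_def by blast
    \<comment> \<open>Both sides equal \<open>- \<delta>\<close> times the first moment: on the
      right the sign comes from the reversed limits.\<close>
    moreover have "integral {0..t} (H_fun \<delta> L Tm C \<Psi> X0 X1) = \<delta> * (LBINT \<sigma>=S t..0. u \<sigma> t)"
      unfolding integral_H_fun_eq_moment[OF assms(1,3,4) t] interval_integral_u[OF t] by simp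
    ultimately show "uy 0 t - \<delta> * (u 0 t)\<^sup>2 = - q * exp (\<delta> * (LBINT \<sigma>=S t..0. u \<sigma> t)) / (\<delta> * C t)"
      by (simp add: uy_def u_ends t)
  next
    fix t \<eta> :: real assume t: "t > 0"
    show "((\<lambda>\<eta>. u \<eta> t) has_real_derivative uy \<eta> t) (at \<eta> within closed_segment 0 (S t))"
      if "\<eta> \<in> closed_segment 0 (S t)"
      unfolding uy_def by (rule u_has_space_derivative[OF t that])
    assume \<eta>: "\<eta> \<in> open_segment 0 (S t)"
    show "((\<lambda>\<eta>. uy \<eta> t) has_real_derivative uyy \<eta> t) (at \<eta>)"
      unfolding uy_def uyy_def by (rule u_has_second_space_derivative[OF t \<eta>])
    show "((\<lambda>s. u \<eta> s) has_real_derivative ut \<eta> t) (at t)"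
      unfolding ut_def by (rule u_has_time_derivative[OF t \<eta>])
    have "\<Psi> (u \<eta> t) t \<noteq> 0" using \<Psi>_nonzero[OF t] u_open[OF t \<eta>] by auto
    then show "ut \<eta> t = uyy \<eta> t - 2 * \<delta> * u \<eta> t * uy \<eta> t"
      by (simp add: ut_def uyy_def uy_def psi_flux_def field_simps power2_eq_square power3_eq_cube)
  qed
qed

end
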